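(* Under the standing hypotheses and with the notation of the context, there exists $k_8\in\mathbb N$ such that for all $k\ge k_8$ and for all $u\in\mathscr U$, the solution $x$ of $(D)$ and the solution $x_{\gamma_k}$ of $(D_{\gamma_k})$, both corresponding to the same control $u$, satisfy $$\|x_{\gamma_k}(t)-x(t)\|^2\le e^{\tilde MT}\sigma_k^2+\frac{8\eta M\,(e^{\tilde MT}-1)}{\tilde M M_\psi}\,\sigma_k,\qquad\forall t\in[0,T],$$ where $\tilde M:=\frac{5MM_\psi}{\eta}+2M$.
   Context: Data: $T>0$; $f\colon\mathbb R^n\times\mathbb R^m\to\mathbb R^n$; $U\subset\mathbb R^m$ nonempty; $\psi_1,\dots,\psi_r\colon\mathbb R^n\to\mathbb R$; $C_i=\{x:\psi_i(x)\le 0\}$, $C=\bigcap_{i=1}^r C_i$; $x_0\in C$. $\mathscr U$ is the set of measurable $u\colon[0,T]\to\mathbb R^m$ with $u(t)\in U$ a.e. $N_C$ and $T_C$ denote the Clarke normal and tangent cones to $C$. $\|\cdot\|$ is the Euclidean norm. Standing hypotheses. (1) $f$ is continuous on $C\times U$; there is $M>0$ such that $x\mapsto f(x,u)$ is $M$-Lipschitz for all $u\in U$ and $\|f(x,u)\|\le M$ for all $(x,u)\in C\times U$. (2) $f(x,U)$ is convex for all $x\in\mathbb R^n$, and $U$ is compact. (3) $C\ne\emptyset$; each $\psi_i$ is $\mathcal C^{1,1}$ (Fréchet differentiable with locally Lipschitz derivative); each $C_i$ is compact, with connected boundary if $n>1$, and convex if $n=1$; and there is $\eta>0$ such that, with $\mathcal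 I^0_x=\{i:\psi_i(x)=0\}$, one has $\|\sum_{i\in\mathcal I^0_c}\lambda_i\nabla\psi_i(c)\|>2\eta$ for every $c\in\mathbb R^n$ with $\mathcal I^0_c\neq\emptyset$ and all $\lambda_i\ge0$ with $\sum_{i\in\mathcal I^0_c}\lambda_i=1$. $(D)$ is the controlled sweeping process $\dot x(t)\in f(x(t),u(t))-N_C(x(t))$ a.e. $t\in[0,T]$, $x(0)=x_0$ (with $x$ absolutely continuous). Approximation. $M_\psi>0$ is such that $2M_\psi$ is a common Lipschitz constant of $\nabla\psi_1,\dots,\nabla\psi_r$ on the convex hull of $C$. $(\gamma_k)_k$ is a sequence with $\gamma_k>2M/\eta$ for all $k$ and $\gamma_k\to\infty$. Put $\alpha_k=\frac{1}{\gamma_k}\ln\!\big(\frac{\eta\gamma_k}{2M}\big)$, $\sigma_k=\frac{rM_\psi}{2\eta^2}\big(\frac{\ln r}{\gamma_k}+\alpha_k\big)$. If $x_0\in\operatorname{int}C$, set $x_0^k=x_0$ for all $k$. If $x_0\in\operatorname{bdry}C$, set $x_0^k=x_0+\sigma_k\, d_{x_0}/\|d_{x_0}\|$, where $d_{c}=\sum_{j\in\mathcal I^0_{c}}v_j(c)$ and $v_j(c)$ is the projection of $-\nabla\psi_j(c)$ onto $T_C(c)$ (it is known that $d_c\neq0$ for $c\in\operatorname{bdry}C$). $(D_{\gamma_k})$ is the control system $\dot x(t)=f(x(t),u(t))-\sum_{i=1}^r\gamma_k e^{\gamma_k\psi_i(x(t))}\nabla\psi_i(x(t))$ a.e. $t\in[0,T]$,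 $x(0)=x_0^k$. (For each control, the solution of $(D)$, and of $(D_{\gamma_k})$ for $k$ large, is unique.) *)

theory Defs
  imports "HOL-Analysis.Analysis"
begin

definition abs_cont_on :: "real \<Rightarrow> real \<Rightarrow> (real \<Rightarrow> 'a::metric_space) \<Rightarrow> bool" where
  "abs_cont_on a b x \<longleftrightarrow>
     (\<forall>\<epsilon>>0. \<exists>\<delta>>0. \<forall>(N::nat) p q.
        (\<forall>i<N. a \<le> p i \<and> p i \<le> q i \<and> q i \<le> b) \<and>
        (\<forall>i<N. \<forall>j<N. i \<noteq> j \<longrightarrow> {p i<..<q i} \<inter> {p j<..<q j} = {}) \<and>
        (\<Sum>i<N. q i - p i) < \<delta> \<longrightarrow>
        (\<Sum>i<N. dist (x (p i)) (x (q i))) < \<epsilon>)"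

definition grad :: "('a::real_inner \<Rightarrow> real) \<Rightarrow> 'a \<Rightarrow> 'a" where
  "grad g x = (THE D. GDERIV g x :> D)"

definition C11 :: "('a::euclidean_space \<Rightarrow> real) \<Rightarrow> bool" where
  "C11 g \<longleftrightarrow> (\<forall>x. g differentiable (at x)) \<and>
     (\<forall>x. \<exists>\<epsilon>>0. \<exists>L. L-lipschitz_on (ball x \<epsilon>) (grad g))"

text \<open>Clarke's tangent cone in its sequential form. Both cones are empty at points outside
  \<^term>\<open>C\<close>, so that a solution of the sweeping process is forced to stay in \<^term>\<open>C\<close>.\<close>

definition clarke_tangent_cone :: "'a::euclidean_space set \<Rightarrow> 'a \<Rightarrow> 'a set" where
  "clarke_tangent_cone C x = {v. x \<in> C \<and>
     (\<forall>y \<tau>. (\<forall>j::nat. y j \<in> C) \<and> y \<longlonglongrightarrow> x \<and> (\<forall>j. 0 < \<tau> j) \<and> \<tau> \<longlonglongrightarrow> (0::real) \<longrightarrow>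
        (\<exists>w. w \<longlonglongrightarrow> v \<and> (\<forall>j. y j + \<tau> j *\<^sub>R w j \<in> C)))}"

definition clarke_normal_cone :: "'a::euclidean_space set \<Rightarrow> 'a \<Rightarrow> 'a set" where
  "clarke_normal_cone C x = {\<zeta>. x \<in> C \<and> (\<forall>v\<in>clarke_tangent_cone C x. \<zeta> \<bullet> v \<le> 0)}"

definition sublevel :: "('a \<Rightarrow> real) \<Rightarrow> 'a set" where
  "sublevel g = {x. g x \<le> 0}"

definition feasible_set :: "nat \<Rightarrow> (nat \<Rightarrow> 'a \<Rightarrow> real) \<Rightarrow> 'a set" where
  "feasible_set r \<psi> = (\<Inter>i\<in>{1..r}. sublevel (\<psi> i))"

definition active :: "nat \<Rightarrow> (nat \<Rightarrow> 'a \<Rightarrow> real) \<Rightarrow> 'a \<Rightarrow> nat set" where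
  "active r \<psi> x = {i\<in>{1..r}. \<psi> i x = 0}"

definition controls :: "real \<Rightarrow> 'b::euclidean_space set \<Rightarrow> (real \<Rightarrow> 'b) set" where
  "controls T U = {u. u \<in> borel_measurable (lebesgue_on {0..T}) \<and>
                      (AE t in lebesgue_on {0..T}. u t \<in> U)}"

definition sweeping_solution ::
  "real \<Rightarrow> ('a::euclidean_space \<Rightarrow> 'b \<Rightarrow> 'a) \<Rightarrow> 'a set \<Rightarrow> 'a \<Rightarrow> (real \<Rightarrow> 'b) \<Rightarrow> (real \<Rightarrow> 'a) \<Rightarrow> bool" where
  "sweeping_solution T f C x0 u x \<longleftrightarrow>
     abs_cont_on 0 T x \<and> x 0 = x0 \<and>
     (AE t in lebesgue_on {0..T}. \<exists>v. (x has_vector_derivative v) (at t within {0..T}) \<and>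
        v \<in> {f (x t) (u t) - \<zeta> |\<zeta>. \<zeta> \<in> clarke_normal_cone C (x t)})"

definition penalized_solution ::
  "real \<Rightarrow> ('a::euclidean_space \<Rightarrow> 'b \<Rightarrow> 'a) \<Rightarrow> nat \<Rightarrow> (nat \<Rightarrow> 'a \<Rightarrow> real) \<Rightarrow> real \<Rightarrow> 'a
     \<Rightarrow> (real \<Rightarrow> 'b) \<Rightarrow> (real \<Rightarrow> 'a) \<Rightarrow> bool" where
  "penalized_solution T f r \<psi> \<gamma> x0 u x \<longleftrightarrow>
     abs_cont_on 0 T x \<and> x 0 = x0 \<and>
     (AE t in lebesgue_on {0..T}.
        (x has_vector_derivative
           (f (x t) (u t) - (\<Sum>i=1..r. (\<gamma> * exp (\<gamma> * \<psi> i (x t))) *\<^sub>R grad (\<psi> i) (x t))))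
        (at t within {0..T}))"

definition alpha_pen :: "real \<Rightarrow> real \<Rightarrow> real \<Rightarrow> real" where
  "alpha_pen M \<eta> \<gamma> = (1 / \<gamma>) * ln (\<eta> * \<gamma> / (2 * M))"

definition sigma_pen :: "nat \<Rightarrow> real \<Rightarrow> real \<Rightarrow> real \<Rightarrow> real \<Rightarrow> real" where
  "sigma_pen r M\<psi> M \<eta> \<gamma> =
     (real r * M\<psi> / (2 * \<eta>\<^sup>2)) * (ln (real r) / \<gamma> + alpha_pen M \<eta> \<gamma>)"

definition inward_direction :: "nat \<Rightarrow> (nat \<Rightarrow> 'a::euclidean_space \<Rightarrow> real) \<Rightarrow> 'a \<Rightarrow> 'a" where
  "inward_direction r \<psi> c =
     (\<Sum>j\<in>active r \<psi> c.
        closest_point (clarke_tangent_cone (feasible_set r \<psi>) c) (- grad (\<psi> j) c))"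

text \<open>For \<^term>\<open>x0\<close> in the closed set \<^term>\<open>feasible_set r \<psi>\<close>, the second case is that of a
  boundary point; \<^term>\<open>\<sigma>\<close> is the length of the inward shift.\<close>

definition initial_point :: "nat \<Rightarrow> (nat \<Rightarrow> 'a::euclidean_space \<Rightarrow> real) \<Rightarrow> 'a \<Rightarrow> real \<Rightarrow> 'a" where
  "initial_point r \<psi> x0 \<sigma> =
     (if x0 \<in> interior (feasible_set r \<psi>) then x0
      else x0 + (\<sigma> / norm (inward_direction r \<psi> x0)) *\<^sub>R inward_direction r \<psi> x0)"

definition M_tilde :: "real \<Rightarrow> real \<Rightarrow> real \<Rightarrow> real" where
  "M_tilde M M\<psi> \<eta> = 5 * M * M\<psi> / \<eta> + 2 * M"

end

theory Submission
  imports Defs "HOL-Real_Asymp.Real_Asymp"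
begin

text \<open>
  The energy \<open>(norm (x\<gamma> - x))\<^sup>2\<close> is estimated by Gronwall's inequality. The penalty contributes
  \<open>p * (- ln p)\<close> for each \<open>p = exp (\<gamma> * \<psi> i)\<close>, which is small when the sum of these exponentials is at
  most \<open>M / (\<eta> * \<gamma>)\<close>. The shifted initial point need not satisfy this bound, because \<open>M\<psi>\<close> does not
  control the size of the gradients; it merely lies in the interior of \<open>C\<close>. However, as long as the sum
  exceeds \<open>M / (\<eta> * \<gamma>)\<close>, the constraint qualification makes the norm of the penalty force at least
  \<open>2 * M\<close>, and the logarithm of the sum decreases at a rate of order \<open>\<gamma>\<close> times the speed of \<open>x\<gamma> - x\<close>.
  So during this initial layer the distance grows by only \<open>O(ln \<gamma> / \<gamma>)\<close>, and afterwards the bound on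
  the sum persists. The layer contributes only \<open>O(\<sigma>\<^sup>2)\<close> to the energy; it is absorbed because \<open>\<sigma>\<close> is
  built on the larger threshold \<open>2 * M / (\<eta> * \<gamma>)\<close>, which leaves room in the term linear in \<open>\<sigma>\<close>.
\<close>

section \<open>Absolutely continuous functions\<close>

text \<open>The bounds on \<open>f\<close> hold only on \<open>C\<close>, so the penalized
  trajectory must first be kept in \<open>C\<close>. The logarithm of the exponential sum does this:
  it starts below 0, and its derivative is nonpositive at almost every time at which it lies between
  \<open>ln (M / (\<eta> * \<gamma>))\<close> and 0, so it never reaches 0. The shift by
  \<open>\<sigma>\<close> only gives \<open>\<psi> i \<le> - (\<kappa> * \<sigma>)\<close>, with
  \<open>\<kappa>\<close> depending on the gradients at \<open>x0\<close>. The initial sum is thus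
  of the order of a power of \<open>1 / \<gamma>\<close> whose exponent
  \<open>\<kappa> * r * M\<psi> / (2 * \<eta>\<^sup>2)\<close> may be below 1; hence the layer. With
  \<open>e = ln (\<eta> * \<gamma> / M) / \<gamma>\<close>, the layer adds at most
  \<open>5 / (2 * \<eta>) * e\<close> to the distance, and the entropy terms put
  \<open>2 * r * M / \<eta> * e\<close> into the differential inequality. The linear term of the
  claim offers about twice that, since \<open>8 * \<eta> * M / M\<psi> * \<sigma>\<close> is
  \<open>4 * r * M / \<eta>\<close> times a quantity asymptotic to \<open>e\<close>. All
  differential inequalities hold only almost everywhere and reduce to one fact: an absolutely
  continuous function with derivative nonpositive almost everywhere does not increase.\<close>

lemma abs_cont_onE:
  assumes "abs_cont_on a b x" "e > 0"
  obtains d where "d > 0" "\<And>(N::nat) p q. (\<And>i. i < N \<Longrightarrow> a \<le> p i \<and> p i \<le> q i \<and> q i \<le> b) \<Longrightarrow>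
      (\<And>i j. i < N \<Longrightarrow> j < N \<Longrightarrow> i \<noteq> j \<Longrightarrow> {p i<..<q i} \<inter> {p j<..<q j} = {}) \<Longrightarrow>
      (\<Sum>i<N. q i - p i) < d \<Longrightarrow> (\<Sum>i<N. dist (x (p i)) (x (q i))) < e"
proof -
  obtain d where d: "d > 0" "\<forall>(N::nat) p q. (\<forall>i<N. a \<le> p i \<and> p i \<le> q i \<and> q i \<le> b) \<and>
      (\<forall>i<N. \<forall>j<N. i \<noteq> j \<longrightarrow> {p i<..<q i} \<inter> {p j<..<q j} = {}) \<and>
      (\<Sum>i<N. q i - p i) < d \<longrightarrow> (\<Sum>i<N. dist (x (p i)) (x (q i))) < e"
    using assms unfolding abs_cont_on_def by (elim allE[of _ e]) (elim impE exE conjE)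
  show ?thesis
  proof (rule that[OF d(1)])
    fix N :: nat and p q :: "nat \<Rightarrow> real"
    assume "\<And>i. i < N \<Longrightarrow> a \<le> p i \<and> p i \<le> q i \<and> q i \<le> b"
      "\<And>i j. i < N \<Longrightarrow> j < N \<Longrightarrow> i \<noteq> j \<Longrightarrow> {p i<..<q i} \<inter> {p j<..<q j} = {}"
      "(\<Sum>i<N. q i - p i) < d"
    then show "(\<Sum>i<N. dist (x (p i)) (x (q i))) < e"
      by (intro d(2)[THEN spec, THEN spec, THEN spec, THEN mp] conjI allI impI) blast+
  qed
qed

lemma abs_cont_onI:
  assumes "\<And>e. e > 0 \<Longrightarrow> \<exists>d>0. \<forall>(N::nat) p q. (\<forall>i<N. a \<le> p i \<and> p i \<le> q i \<and> q i \<le> b) \<longrightarrow>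
      (\<forall>i<N. \<forall>j<N. i \<noteq> j \<longrightarrow> {p i<..<q i} \<inter> {p j<..<q j} = {}) \<longrightarrow>
      (\<Sum>i<N. q i - p i) < d \<longrightarrow> (\<Sum>i<N. dist (x (p i)) (x (q i))) < e"
  shows "abs_cont_on a b x"
  using assms unfolding abs_cont_on_def imp_conjL by blast

text \<open>A fine tagged division replaces integration of the derivative. Intervals tagged in the
  exceptional set lie in an open set of measure below \<open>\<delta>\<close>, so absolute
  continuity bounds their total increment by \<open>e\<close>; on every other interval the straddle
  estimate at the tag bounds the increment by \<open>e\<close> times the length.\<close>

lemma abs_cont_on_nonincreasing:
  fixes g :: "real \<Rightarrow> real"
  assumes ab: "a \<le> b" and ac: "abs_cont_on a b g" and N: "negligible N"
    and der: "\<And>t. t \<in> {a<..<b} - N \<Longrightarrow> \<exists>d\<le>0. (g has_real_derivative d) (at t within {a..b})"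
  shows "g b \<le> g a"
proof (rule field_le_epsilon)
  fix e0 :: real assume "e0 > 0"
  define e where "e = e0 / (b - a + 1)"
  have e: "e > 0" using \<open>e0 > 0\<close> ab by (simp add: e_def)
  \<comment> \<open>The endpoints join the null set because \<open>der\<close> speaks only of the
    open interval.\<close>
  define N' where "N' = N \<union> {a, b}"
  have N': "negligible N'" unfolding N'_def using N by (auto intro: negligible_Un)
  from abs_cont_onE[OF ac e] obtain \<delta> where \<delta>: "\<delta> > 0" and D: "\<And>(N::nat) p q. (\<And>i. i < N \<Longrightarrow> a \<le> p i \<and> p i \<le> q i \<and> q i \<le> b) \<Longrightarrow>
      (\<And>i j. i < N \<Longrightarrow> j < N \<Longrightarrow> i \<noteq> j \<Longrightarrow> {p i<..<q i} \<inter> {p j<..<q j} = {}) \<Longrightarrow>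
      (\<Sum>i<N. q i - p i) < \<delta> \<Longrightarrow> (\<Sum>i<N. dist (g (p i)) (g (q i))) < e" by blast
  obtain G where G: "open G" "N' \<subseteq> G" "G - N' \<in> lmeasurable" "emeasure lebesgue (G - N') < ennreal \<delta>"
    using sets_lebesgue_outer_open[OF negligible_imp_sets[OF N'] \<delta>] by metis
  have "G = (G - N') \<union> N'" using G(2) by auto
  then have Gm: "G \<in> lmeasurable"
    using G(3) negligible_imp_measurable[OF N'] fmeasurable.Un by metis
  have "measure lebesgue G = measure lebesgue (G - N')"
    using N' Gm by (simp add: measure_Diff_null_set negligible_iff_null_sets fmeasurableD)
  then have Gd: "measure lebesgue G < \<delta>"
    using G(3,4) \<delta> by (simp add: emeasure_eq_measure2 ennreal_less_iff)
  have "\<exists>\<rho>>0. (t \<in> N' \<longrightarrow> ball t \<rho> \<subseteq> G) \<and> (t \<in> {a..b} - N' \<longrightarrow>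
      (\<forall>s\<in>{a..b}. \<bar>s - t\<bar> < \<rho> \<longrightarrow> (t \<le> s \<longrightarrow> g s - g t \<le> e * (s - t)) \<and> (s \<le> t \<longrightarrow> g t - g s \<le> e * (t - s))))" for t
  proof (cases "t \<in> N'")
    case True
    then show ?thesis using G(1,2) open_contains_ball by (metis DiffE subsetD)
  next
    case out: False
    show ?thesis
    proof (cases "t \<in> {a..b}")
      case True
      then have "t \<in> {a<..<b} - N" using out by (auto simp: N'_def)
      then obtain d where d: "d \<le> 0" "(g has_real_derivative d) (at t within {a..b})"
        using der by blast
      then have "(g has_derivative (*) d) (at t within {a..b})"
        by (simp add: has_field_derivative_def)
      then obtain \<rho> where \<rho>: "\<rho> > 0" "\<And>s. s \<in> {a..b} \<Longrightarrow> \<bar>s - t\<bar> < \<rho> \<Longrightarrow> \<bar>g s - g t - d * (s - t)\<bar> \<le> e * \<bar>s - t\<bar>"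
        using e unfolding has_derivative_within_alt by (force simp: dist_norm)
      have "(t \<le> s \<longrightarrow> g s - g t \<le> e * (s - t)) \<and> (s \<le> t \<longrightarrow> g t - g s \<le> e * (t - s))"
        if "s \<in> {a..b}" "\<bar>s - t\<bar> < \<rho>" for s
      proof -
        have *: "\<bar>g s - g t - d * (s - t)\<bar> \<le> e * \<bar>s - t\<bar>" using \<rho>(2) that by blast
        have "d * (s - t) \<le> 0" if "t \<le> s" using d(1) that by (simp add: mult_nonpos_nonneg)
        moreover have "d * (s - t) \<ge> 0" if "s \<le> t" using d(1) that by (simp add: mult_nonpos_nonpos)
        ultimately show ?thesis using * by (smt (verit))
      qed
      then show ?thesis using \<rho>(1) out by blast
    qed (use out in \<open>auto intro: exI[of _ 1]\<close>)
  qed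
  then obtain \<rho> where \<rho>: "\<And>t. \<rho> t > 0" "\<And>t. t \<in> N' \<Longrightarrow> ball t (\<rho> t) \<subseteq> G"
    "\<And>t s. t \<in> {a..b} - N' \<Longrightarrow> s \<in> {a..b} \<Longrightarrow> \<bar>s - t\<bar> < \<rho> t \<Longrightarrow>
       (t \<le> s \<longrightarrow> g s - g t \<le> e * (s - t)) \<and> (s \<le> t \<longrightarrow> g t - g s \<le> e * (t - s))"
    by metis
  have "gauge (\<lambda>t. ball t (\<rho> t))" using \<rho>(1) by (rule gauge_ball_dependent[rule_format])
  then obtain p where p: "p tagged_division_of {a..b}" "(\<lambda>t. ball t (\<rho> t)) fine p"
    by (rule fine_division_exists_real)
  note pD = tagged_division_ofD[OF p(1)]
  have K: "K = {Inf K..Sup K} \<and> Inf K \<le> t \<and> t \<le> Sup K \<and> a \<le> Inf K \<and> Sup K \<le> b \<and> K \<subseteq> ball t (\<rho> t)"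
    if tK: "(t, K) \<in> p" for t K
  proof -
    obtain c d where cd: "K = {c..d}" using pD(4)[OF tK] by auto
    have "c \<le> d" using pD(2)[OF tK] cd by auto
    then show ?thesis using cd pD(2,3)[OF tK] fineD[OF p(2) tK] by auto
  qed
  define p1 where "p1 = {x \<in> p. fst x \<in> N'}"
  define p2 where "p2 = {x \<in> p. fst x \<notin> N'}"
  have fin: "finite p" "finite p1" "finite p2" using pD(1) by (auto simp: p1_def p2_def)
  have pp: "p = p1 \<union> p2" "p1 \<inter> p2 = {}" by (auto simp: p1_def p2_def)
  define F where "F = (\<lambda>x::real \<times> real set. g (Sup (snd x)) - g (Inf (snd x)))"
  have len: "(\<Sum>x\<in>p. Sup (snd x) - Inf (snd x)) = b - a"
    using additive_tagged_division_1[OF ab p(1), of "\<lambda>x. x"] by (simp add: case_prod_beta)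
  have "sum F p2 \<le> (\<Sum>x\<in>p2. e * (Sup (snd x) - Inf (snd x)))"
  proof (rule sum_mono)
    fix x assume x: "x \<in> p2"
    obtain t K where tK: "x = (t, K)" by force
    have inp: "(t, K) \<in> p" using x tK by (auto simp: p2_def)
    note k = K[OF inp]
    have t: "t \<in> {a..b} - N'" using x tK k by (auto simp: p2_def)
    have "Sup K \<in> K" "Inf K \<in> K" using k by (metis atLeastAtMost_iff order.refl order.trans)+
    then have "\<bar>Sup K - t\<bar> < \<rho> t" "\<bar>Inf K - t\<bar> < \<rho> t" using k
      by (metis abs_minus_commute dist_real_def mem_ball subsetD)+
    then have "g (Sup K) - g t \<le> e * (Sup K - t)" "g t - g (Inf K) \<le> e * (t - Inf K)"
      using \<rho>(3)[OF t] k by auto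
    then show "F x \<le> e * (Sup (snd x) - Inf (snd x))"
      by (simp add: F_def tK algebra_simps)
  qed
  also have "\<dots> \<le> (\<Sum>x\<in>p. e * (Sup (snd x) - Inf (snd x)))"
    using fin e K by (intro sum_mono2) (force simp: p2_def)+
  also have "\<dots> = e * (b - a)" using len by (simp add: sum_distrib_left[symmetric])
  finally have s2: "sum F p2 \<le> e * (b - a)" .
  obtain h where h: "bij_betw h {0..<card p1} p1" using ex_bij_betw_nat_finite[OF fin(2)] by blast
  define P Q where "P i = Inf (snd (h i))" and "Q i = Sup (snd (h i))" for i
  have hp: "(fst (h i), snd (h i)) \<in> p" "fst (h i) \<in> N'" if "i < card p1" for i
    using h that by (auto simp: bij_betw_def p1_def)
  have snd_h: "snd (h i) = {P i..Q i}" "a \<le> P i" "P i \<le> Q i" "Q i \<le> b" "{P i..Q i} \<subseteq> G" if "i < card p1" for i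
    using K[OF hp(1)[OF that]] \<rho>(2)[OF hp(2)[OF that]] by (auto simp: P_def Q_def)
  have dis: "{P i<..<Q i} \<inter> {P j<..<Q j} = {}" if "i < card p1" "j < card p1" "i \<noteq> j" for i j
  proof -
    have "h i \<noteq> h j" using h that by (auto simp: bij_betw_def inj_on_def)
    then have "interior (snd (h i)) \<inter> interior (snd (h j)) = {}"
      using pD(5)[OF hp(1)[OF that(1)] hp(1)[OF that(2)]] by simp
    then show ?thesis using snd_h(1) that by simp
  qed
  have "(\<Sum>i<card p1. Q i - P i) = (\<Sum>i<card p1. measure lebesgue {P i<..<Q i})"
    using snd_h by (intro sum.cong) auto
  also have "\<dots> = measure lebesgue (\<Union>i<card p1. {P i<..<Q i})"
    by (rule measure_negligible_finite_Union_image[symmetric]) (auto simp: pairwise_def dis simp del: Int_greaterThanLessThan)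
  also have "\<dots> \<le> measure lebesgue G"
  proof (rule measure_mono_fmeasurable)
    show "(\<Union>i<card p1. {P i<..<Q i}) \<subseteq> G"
      using snd_h(5) greaterThanLessThan_subseteq_atLeastAtMost_iff by blast
  qed (use Gm in auto)
  finally have "(\<Sum>i<card p1. Q i - P i) < \<delta>" using Gd by simp
  then have "(\<Sum>i<card p1. dist (g (P i)) (g (Q i))) < e"
    using snd_h dis by (intro D) auto
  moreover have "sum F p1 = (\<Sum>i<card p1. g (Q i) - g (P i))"
    using sum.reindex_bij_betw[OF h, of F] by (simp add: F_def P_def Q_def lessThan_atLeast0)
  moreover have "(\<Sum>i<card p1. g (Q i) - g (P i)) \<le> (\<Sum>i<card p1. dist (g (P i)) (g (Q i)))"
    by (intro sum_mono) (auto simp: dist_real_def)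
  ultimately have s1: "sum F p1 \<le> e" by linarith
  have "g b - g a = sum F p"
    using additive_tagged_division_1[OF ab p(1), of g] by (simp add: case_prod_beta F_def)
  also have "\<dots> = sum F p1 + sum F p2" unfolding pp(1) using fin pp(2) by (intro sum.union_disjoint) auto
  also have "\<dots> \<le> e * (b - a + 1)" using s1 s2 by (simp add: algebra_simps)
  also have "\<dots> = e0" using ab by (simp add: e_def)
  finally show "g b \<le> g a + e0" by simp
qed

section \<open>Closure properties of absolute continuity\<close>

lemma abs_cont_on_subinterval:
  assumes x: "abs_cont_on a b x" and "a \<le> a'" "b' \<le> b"
  shows "abs_cont_on a' b' x"
proof (rule abs_cont_onI)
  fix e :: real assume "e > 0"
  from abs_cont_onE[OF x this] obtain d where d: "d > 0" "\<And>(N::nat) p q. (\<And>i. i < N \<Longrightarrow> a \<le> p i \<and> p i \<le> q i \<and> q i \<le> b) \<Longrightarrow>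
      (\<And>i j. i < N \<Longrightarrow> j < N \<Longrightarrow> i \<noteq> j \<Longrightarrow> {p i<..<q i} \<inter> {p j<..<q j} = {}) \<Longrightarrow>
      (\<Sum>i<N. q i - p i) < d \<Longrightarrow> (\<Sum>i<N. dist (x (p i)) (x (q i))) < e" by blast
  show "\<exists>d>0. \<forall>(N::nat) p q. (\<forall>i<N. a' \<le> p i \<and> p i \<le> q i \<and> q i \<le> b') \<longrightarrow>
      (\<forall>i<N. \<forall>j<N. i \<noteq> j \<longrightarrow> {p i<..<q i} \<inter> {p j<..<q j} = {}) \<longrightarrow>
      (\<Sum>i<N. q i - p i) < d \<longrightarrow> (\<Sum>i<N. dist (x (p i)) (x (q i))) < e"
  proof (intro exI[of _ d] conjI allI impI d(1))
    fix N :: nat and p q :: "nat \<Rightarrow> real"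
    assume h: "\<forall>i<N. a' \<le> p i \<and> p i \<le> q i \<and> q i \<le> b'"
      "\<forall>i<N. \<forall>j<N. i \<noteq> j \<longrightarrow> {p i<..<q i} \<inter> {p j<..<q j} = {}" "(\<Sum>i<N. q i - p i) < d"
    have "a \<le> p i \<and> p i \<le> q i \<and> q i \<le> b" if "i < N" for i
      using h(1) that assms(2,3) by (meson order.trans)
    then show "(\<Sum>i<N. dist (x (p i)) (x (q i))) < e" using h(2,3) by (intro d(2)) auto
  qed
qed

text \<open>Sums, differences, products and compositions are all reduced to this comparison of
  increments; with a single source function, \<open>L = 0\<close>.\<close>

lemma abs_cont_on_dominated:
  assumes x: "abs_cont_on a b x" and y: "abs_cont_on a b y"
    and dom: "\<And>s t. s \<in> {a..b} \<Longrightarrow> t \<in> {a..b} \<Longrightarrow> dist (z s) (z t) \<le> K * dist (x s) (x t) + L * dist (y s) (y t)"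
  shows "abs_cont_on a b z"
proof (rule abs_cont_onI)
  fix e :: real assume e: "e > 0"
  \<comment> \<open>The maximum with 1 keeps \<open>B\<close> positive, so that
    \<open>e / (2 * B)\<close> is a legitimate tolerance whatever the signs of \<open>K\<close> and
    \<open>L\<close>.\<close>
  define B where "B = max 1 (max K L)"
  have B: "B \<ge> 1" "B \<ge> K" "B \<ge> L" by (auto simp: B_def)
  have eB: "e / (2 * B) > 0" using e B(1) by simp
  from abs_cont_onE[OF x this] obtain d where d: "d > 0" "\<And>(N::nat) p q. (\<And>i. i < N \<Longrightarrow> a \<le> p i \<and> p i \<le> q i \<and> q i \<le> b) \<Longrightarrow>
      (\<And>i j. i < N \<Longrightarrow> j < N \<Longrightarrow> i \<noteq> j \<Longrightarrow> {p i<..<q i} \<inter> {p j<..<q j} = {}) \<Longrightarrow>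
      (\<Sum>i<N. q i - p i) < d \<Longrightarrow> (\<Sum>i<N. dist (x (p i)) (x (q i))) < e / (2 * B)" by blast
  from abs_cont_onE[OF y eB] obtain d' where d': "d' > 0" "\<And>(N::nat) p q. (\<And>i. i < N \<Longrightarrow> a \<le> p i \<and> p i \<le> q i \<and> q i \<le> b) \<Longrightarrow>
      (\<And>i j. i < N \<Longrightarrow> j < N \<Longrightarrow> i \<noteq> j \<Longrightarrow> {p i<..<q i} \<inter> {p j<..<q j} = {}) \<Longrightarrow>
      (\<Sum>i<N. q i - p i) < d' \<Longrightarrow> (\<Sum>i<N. dist (y (p i)) (y (q i))) < e / (2 * B)" by blast
  show "\<exists>d>0. \<forall>(N::nat) p q. (\<forall>i<N. a \<le> p i \<and> p i \<le> q i \<and> q i \<le> b) \<longrightarrow>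
      (\<forall>i<N. \<forall>j<N. i \<noteq> j \<longrightarrow> {p i<..<q i} \<inter> {p j<..<q j} = {}) \<longrightarrow>
      (\<Sum>i<N. q i - p i) < d \<longrightarrow> (\<Sum>i<N. dist (z (p i)) (z (q i))) < e"
  proof (intro exI[of _ "min d d'"] conjI allI impI)
    fix N :: nat and p q :: "nat \<Rightarrow> real"
    assume h: "\<forall>i<N. a \<le> p i \<and> p i \<le> q i \<and> q i \<le> b"
      "\<forall>i<N. \<forall>j<N. i \<noteq> j \<longrightarrow> {p i<..<q i} \<inter> {p j<..<q j} = {}" "(\<Sum>i<N. q i - p i) < min d d'"
    have X: "(\<Sum>i<N. dist (x (p i)) (x (q i))) < e / (2 * B)" using h by (intro d(2)) auto
    have Y: "(\<Sum>i<N. dist (y (p i)) (y (q i))) < e / (2 * B)" using h by (intro d'(2)) auto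
    have "(\<Sum>i<N. dist (z (p i)) (z (q i))) \<le> (\<Sum>i<N. B * dist (x (p i)) (x (q i)) + B * dist (y (p i)) (y (q i)))"
    proof (rule sum_mono)
      fix i assume "i \<in> {..<N}"
      then have i: "p i \<in> {a..b}" "q i \<in> {a..b}" using h(1) by (auto intro: order.trans)
      show "dist (z (p i)) (z (q i)) \<le> B * dist (x (p i)) (x (q i)) + B * dist (y (p i)) (y (q i))"
        using dom[OF i] mult_right_mono[OF B(2), of "dist (x (p i)) (x (q i))"]
          mult_right_mono[OF B(3), of "dist (y (p i)) (y (q i))"] by simp
    qed
    also have "\<dots> = B * (\<Sum>i<N. dist (x (p i)) (x (q i))) + B * (\<Sum>i<N. dist (y (p i)) (y (q i)))"
      by (simp add: sum.distrib sum_distrib_left)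
    also have "\<dots> < B * (e / (2 * B)) + B * (e / (2 * B))"
      using X Y B(1) by (intro add_strict_mono mult_strict_left_mono) auto
    also have "\<dots> = e" using B(1) by simp
    finally show "(\<Sum>i<N. dist (z (p i)) (z (q i))) < e" .
  qed (use d(1) d'(1) in auto)
qed

lemma abs_cont_on_imp_continuous_on:
  assumes x: "abs_cont_on a b x"
  shows "continuous_on {a..b} x"
  unfolding continuous_on_iff
proof (intro ballI allI impI)
  fix t and e :: real assume t: "t \<in> {a..b}" and "e > 0"
  from abs_cont_onE[OF x this(2)] obtain d where d: "d > 0" "\<And>(N::nat) p q. (\<And>i. i < N \<Longrightarrow> a \<le> p i \<and> p i \<le> q i \<and> q i \<le> b) \<Longrightarrow>
      (\<And>i j. i < N \<Longrightarrow> j < N \<Longrightarrow> i \<noteq> j \<Longrightarrow> {p i<..<q i} \<inter> {p j<..<q j} = {}) \<Longrightarrow>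
      (\<Sum>i<N. q i - p i) < d \<Longrightarrow> (\<Sum>i<N. dist (x (p i)) (x (q i))) < e" by blast
  have "dist (x s) (x t) < e" if "s \<in> {a..b}" "dist s t < d" for s
  proof -
    have "dist (x (min s t)) (x (max s t)) < e"
      using d(2)[of 1 "\<lambda>_. min s t" "\<lambda>_. max s t"] that t by (auto simp: dist_real_def)
    then show ?thesis by (cases "s \<le> t") (auto simp: dist_commute)
  qed
  then show "\<exists>d>0. \<forall>x'\<in>{a..b}. dist x' t < d \<longrightarrow> dist (x x') (x t) < e" using d(1) by blast
qed

lemma abs_cont_on_add:
  fixes x y :: "real \<Rightarrow> 'a::real_normed_vector"
  assumes "abs_cont_on a b x" "abs_cont_on a b y"
  shows "abs_cont_on a b (\<lambda>t. x t + y t)"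
  by (rule abs_cont_on_dominated[OF assms, of _ 1 1]) (simp add: dist_triangle_add)

lemma abs_cont_on_diff:
  fixes x y :: "real \<Rightarrow> 'a::real_normed_vector"
  assumes "abs_cont_on a b x" "abs_cont_on a b y"
  shows "abs_cont_on a b (\<lambda>t. x t - y t)"
proof (rule abs_cont_on_dominated[OF assms, of _ 1 1])
  fix s t
  have "x s - y s - (x t - y t) = (x s - x t) - (y s - y t)" by simp
  then show "dist (x s - y s) (x t - y t) \<le> 1 * dist (x s) (x t) + 1 * dist (y s) (y t)"
    unfolding dist_norm by (metis mult_1 norm_triangle_ineq4)
qed

lemma abs_cont_on_lipschitz:
  assumes x: "abs_cont_on a b x" and L: "L-lipschitz_on S g" and S: "x ` {a..b} \<subseteq> S"
  shows "abs_cont_on a b (\<lambda>t. g (x t))"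
  by (rule abs_cont_on_dominated[OF x x, of _ L 0]) (use L S in \<open>auto simp: lipschitz_on_def image_subset_iff\<close>)

lemma abs_cont_on_ident: "abs_cont_on a b (\<lambda>t. t)"
proof (rule abs_cont_onI)
  fix e :: real assume "e > 0"
  moreover have "(\<Sum>i<N. dist (p i) (q i)) = (\<Sum>i<N. q i - p i)"
    if "\<forall>i<N. a \<le> p i \<and> p i \<le> q i \<and> q i \<le> b" for N :: nat and p q :: "nat \<Rightarrow> real"
    using that by (intro sum.cong) (auto simp: dist_real_def)
  ultimately show "\<exists>d>0. \<forall>(N::nat) p q. (\<forall>i<N. a \<le> p i \<and> p i \<le> q i \<and> q i \<le> b) \<longrightarrow>
      (\<forall>i<N. \<forall>j<N. i \<noteq> j \<longrightarrow> {p i<..<q i} \<inter> {p j<..<q j} = {}) \<longrightarrow>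
      (\<Sum>i<N. q i - p i) < d \<longrightarrow> (\<Sum>i<N. dist (p i) (q i)) < e"
    by (intro exI[of _ e]) simp
qed

lemma abs_cont_on_mult:
  fixes x y :: "real \<Rightarrow> real"
  assumes x: "abs_cont_on a b x" and y: "abs_cont_on a b y"
  shows "abs_cont_on a b (\<lambda>t. x t * y t)"
proof -
  have "bounded (x ` {a..b})" "bounded (y ` {a..b})"
    using assms by (auto intro!: compact_imp_bounded compact_continuous_image abs_cont_on_imp_continuous_on)
  then obtain A B where A: "\<And>t. t \<in> {a..b} \<Longrightarrow> \<bar>x t\<bar> \<le> A" and B: "\<And>t. t \<in> {a..b} \<Longrightarrow> \<bar>y t\<bar> \<le> B"
    unfolding bounded_iff by (metis image_eqI real_norm_def)
  show ?thesis
  proof (rule abs_cont_on_dominated[OF x y, of _ B A])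
    fix s t assume st: "s \<in> {a..b}" "t \<in> {a..b}"
    have "x s * y s - x t * y t = y s * (x s - x t) + x t * (y s - y t)" by (simp add: algebra_simps)
    then have "\<bar>x s * y s - x t * y t\<bar> \<le> \<bar>y s\<bar> * \<bar>x s - x t\<bar> + \<bar>x t\<bar> * \<bar>y s - y t\<bar>"
      by (metis abs_mult abs_triangle_ineq)
    also have "\<dots> \<le> B * \<bar>x s - x t\<bar> + A * \<bar>y s - y t\<bar>"
      using A[OF st(2)] B[OF st(1)] by (intro add_mono mult_right_mono) auto
    finally show "dist (x s * y s) (x t * y t) \<le> B * dist (x s) (x t) + A * dist (y s) (y t)"
      by (simp add: dist_real_def)
  qed
qed

text \<open>The trajectory is compact, hence inside a ball; on that convex set the continuous
  gradient is bounded, which makes \<open>g\<close> Lipschitz there.\<close>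

lemma abs_cont_on_gradient:
  fixes x :: "real \<Rightarrow> 'a::euclidean_space"
  assumes x: "abs_cont_on a b x" and der: "\<And>z. GDERIV g z :> D z" and cont: "continuous_on UNIV D"
  shows "abs_cont_on a b (\<lambda>t. g (x t))"
proof -
  have "compact (x ` {a..b})"
    using x by (intro compact_continuous_image abs_cont_on_imp_continuous_on) auto
  then obtain R where R: "x ` {a..b} \<subseteq> cball 0 R"
    using compact_imp_bounded bounded_subset_ballD[of _ 0] ball_subset_cball by (metis order.trans)
  have "bounded (D ` cball 0 R)"
    by (intro compact_imp_bounded compact_continuous_image continuous_on_subset[OF cont]) auto
  then obtain L where L: "\<And>z. z \<in> cball 0 R \<Longrightarrow> norm (D z) \<le> L" "L \<ge> 0"
    by (metis bounded_pos image_eqI less_imp_le)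
  have "L-lipschitz_on (cball 0 R) g"
  proof (rule bounded_derivative_imp_lipschitz[where f' = "\<lambda>z h. inner h (D z)"])
    fix z :: 'a assume z: "z \<in> cball 0 R"
    show "(g has_derivative (\<lambda>h. h \<bullet> D z)) (at z within cball 0 R)"
      using der[of z] by (simp add: gderiv_def has_derivative_at_withinI)
    show "onorm (\<lambda>h. h \<bullet> D z) \<le> L"
    proof (rule onorm_bound)
      fix h show "norm (h \<bullet> D z) \<le> L * norm h"
        using Cauchy_Schwarz_ineq2[of h "D z"] mult_left_mono[OF L(1)[OF z], of "norm h"] by (simp add: mult.commute)
    qed (rule L(2))
  qed (use L in auto)
  then show ?thesis by (rule abs_cont_on_lipschitz[OF x _ R])
qed

lemma GDERIV_compose_vector_derivative:
  assumes "GDERIV g (x t) :> d" "(x has_vector_derivative v) (at t within S)"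
  shows "((\<lambda>t. g (x t)) has_real_derivative (v \<bullet> d)) (at t within S)"
proof -
  have "((\<lambda>t. g (x t)) has_derivative (\<lambda>h. (h *\<^sub>R v) \<bullet> d)) (at t within S)"
    using assms has_derivative_compose[of x "\<lambda>h. h *\<^sub>R v" t S g "\<lambda>h. h \<bullet> d"]
    by (simp add: gderiv_def has_vector_derivative_def)
  then show ?thesis
    unfolding has_field_derivative_def by (rule has_derivative_eq_rhs) (simp add: fun_eq_iff mult.commute)
qed

section \<open>Comparison principles under derivative conditions that hold almost everywhere\<close>

text \<open>After the last time \<open>s\<close> with \<open>g s \<le> c\<close>, continuity keeps
  \<open>g\<close> inside the band below \<open>c'\<close> for a short while; there \<open>g\<close>
  cannot increase, so it cannot have left the level \<open>c\<close>. The band matters because in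
  the application the sign of the derivative is known only while the penalized state lies in
  \<open>C\<close>.\<close>

lemma abs_cont_on_barrier:
  fixes g :: "real \<Rightarrow> real"
  assumes ac: "abs_cont_on a b g" and N: "negligible N" and ga: "g a \<le> c" and "c < c'"
    and der: "\<And>t. t \<in> {a<..<b} - N \<Longrightarrow> c < g t \<Longrightarrow> g t < c' \<Longrightarrow>
      \<exists>d\<le>0. (g has_real_derivative d) (at t within {a..b})"
    and t: "t \<in> {a..b}"
  shows "g t \<le> c"
proof (rule ccontr)
  assume gt: "\<not> g t \<le> c"
  have cont: "continuous_on {a..b} g" using ac by (rule abs_cont_on_imp_continuous_on)
  define A where "A = {a..t} \<inter> g -` {..c}"
  have "closed A"
    unfolding A_def using continuous_closed_preimage[OF continuous_on_subset[OF cont], of "{a..t}" "{..c}"] t by auto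
  then have "compact ({a..t} \<inter> A)" by (intro compact_Int_closed compact_Icc)
  then have "compact A" by (simp add: A_def)
  moreover have "a \<in> A" using t ga by (auto simp: A_def)
  ultimately obtain s where s: "s \<in> A" "\<And>s'. s' \<in> A \<Longrightarrow> s' \<le> s"
    using compact_attains_sup[of A] by blast
  have st: "a \<le> s" "s < t" "g s \<le> c" using s(1) gt by (auto simp: A_def less_le)
  have above: "c < g s'" if "s < s'" "s' \<le> t" for s'
    using s(2)[of s'] that st(1) by (cases "g s' \<le> c") (auto simp: A_def)
  have "continuous (at s within {a..b}) g" using cont st t by (auto simp: continuous_on_eq_continuous_within)
  then obtain d where d: "d > 0" "\<And>s'. s' \<in> {a..b} \<Longrightarrow> dist s' s < d \<Longrightarrow> dist (g s') (g s) < c' - c"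
    using \<open>c < c'\<close> unfolding continuous_within_eps_delta by (meson diff_gt_0_iff_gt)
  define t' where "t' = min t (s + d / 2)"
  have t': "s < t'" "t' \<le> t" "t' \<in> {a..b}" using d(1) st t by (auto simp: t'_def)
  have below: "g s' < c'" if "s' \<in> {s..t'}" for s'
  proof -
    have "dist (g s') (g s) < c' - c" using that t' st t d(1) by (intro d(2)) (auto simp: t'_def dist_real_def)
    then show ?thesis using st(3) by (auto simp: dist_real_def)
  qed
  have "g t' \<le> g s"
  proof (rule abs_cont_on_nonincreasing[OF _ abs_cont_on_subinterval[OF ac] N])
    fix \<tau> assume \<tau>: "\<tau> \<in> {s<..<t'} - N"
    then have "\<tau> \<in> {a<..<b} - N" using st t' t by auto
    then obtain d where "d \<le> 0" "(g has_real_derivative d) (at \<tau> within {a..b})"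
      using der[of \<tau>] above[of \<tau>] below[of \<tau>] \<tau> t' by auto
    then show "\<exists>d\<le>0. (g has_real_derivative d) (at \<tau> within {s..t'})"
      using DERIV_subset[of g d \<tau> "{a..b}" "{s..t'}"] st t t' by auto
  qed (use st t t' in auto)
  then show False using above[of t'] t' st by auto
qed

text \<open>Pairing with the unit vector along the total increment reduces the claim to the
  monotonicity of a scalar function, so the norm is never differentiated. The decrease of
  \<open>g\<close> pays for the displacement of \<open>z\<close>.\<close>

lemma abs_cont_on_norm_bound:
  fixes z :: "real \<Rightarrow> 'a::real_inner"
  assumes ab: "a \<le> b" and z: "abs_cont_on a b z" and g: "abs_cont_on a b g" and N: "negligible N"
    and der: "\<And>t. t \<in> {a<..<b} - N \<Longrightarrow> \<exists>v d. (z has_vector_derivative v) (at t within {a..b}) \<and>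
      (g has_real_derivative d) (at t within {a..b}) \<and> norm v \<le> - d"
  shows "norm (z b - z a) \<le> g a - g b"
proof -
  \<comment> \<open>\<open>sgn\<close> returns 0 if the two ends coincide, so only
    \<open>norm w \<le> 1\<close> is claimed and that case needs no separate treatment.\<close>
  define w where "w = sgn (z b - z a)"
  have w1: "norm w \<le> 1" by (simp add: w_def norm_sgn)
  have zw: "abs_cont_on a b (\<lambda>t. z t \<bullet> w)"
  proof (rule abs_cont_on_lipschitz[OF z, of 1 UNIV])
    show "1-lipschitz_on UNIV (\<lambda>x. x \<bullet> w)"
    proof (rule lipschitz_onI)
      fix x y :: 'a
      have "\<bar>(x - y) \<bullet> w\<bar> \<le> norm (x - y) * norm w" by (rule Cauchy_Schwarz_ineq2)
      also have "\<dots> \<le> norm (x - y)" using w1 by (simp add: mult_left_le)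
      finally show "dist (x \<bullet> w) (y \<bullet> w) \<le> 1 * dist x y" by (simp add: dist_norm inner_diff_left)
    qed simp
  qed simp
  have "z b \<bullet> w + g b \<le> z a \<bullet> w + g a"
  proof (rule abs_cont_on_nonincreasing[OF ab abs_cont_on_add[OF zw g] N])
    fix t assume "t \<in> {a<..<b} - N"
    then obtain v d where vd: "(z has_vector_derivative v) (at t within {a..b})"
      "(g has_real_derivative d) (at t within {a..b})" "norm v \<le> - d" using der by blast
    have "((\<lambda>t. z t \<bullet> w) has_real_derivative v \<bullet> w) (at t within {a..b})"
      by (rule GDERIV_compose_vector_derivative[OF _ vd(1)])
        (simp add: gderiv_def bounded_linear_imp_has_derivative bounded_linear_inner_left)
    then have "((\<lambda>t. z t \<bullet> w + g t) has_real_derivative v \<bullet> w + d) (at t within {a..b})"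
      using vd(2) by (rule DERIV_add)
    moreover have "v \<bullet> w \<le> norm v"
      using Cauchy_Schwarz_ineq2[of v w] mult_left_le[OF w1 norm_ge_zero[of v]] by simp
    ultimately show "\<exists>d\<le>0. ((\<lambda>t. z t \<bullet> w + g t) has_real_derivative d) (at t within {a..b})"
      using vd(3) by (intro exI[of _ "v \<bullet> w + d"]) simp
  qed
  moreover have "(z b - z a) \<bullet> w = norm (z b - z a)"
    by (cases "z b = z a") (simp_all add: w_def sgn_div_norm dot_square_norm power2_eq_square)
  ultimately show ?thesis by (simp add: inner_diff_left)
qed

text \<open>The shift by \<open>B / A\<close> absorbs the constant term, and the integrating factor
  \<open>exp (- A * t)\<close> makes the shifted function nonincreasing.\<close>

lemma abs_cont_on_gronwall:
  fixes g :: "real \<Rightarrow> real"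
  assumes ab: "a \<le> b" and g: "abs_cont_on a b g" and N: "negligible N" and A: "A > 0"
    and der: "\<And>t. t \<in> {a<..<b} - N \<Longrightarrow>
      \<exists>d. (g has_real_derivative d) (at t within {a..b}) \<and> d \<le> A * g t + B"
  shows "g b \<le> exp (A * (b - a)) * g a + B * (exp (A * (b - a)) - 1) / A"
proof -
  have E: "abs_cont_on a b (\<lambda>t. exp (- A * t))"
  proof (rule abs_cont_on_gradient[OF abs_cont_on_ident])
    show "GDERIV (\<lambda>t. exp (- A * t)) z :> - A * exp (- A * z)" for z
      by (auto intro!: derivative_eq_intros)
  qed (intro continuous_intros)
  have G: "abs_cont_on a b (\<lambda>t. g t + B / A)"
    by (rule abs_cont_on_dominated[OF g g, of _ 1 0]) simp
  have "exp (- A * b) * (g b + B / A) \<le> exp (- A * a) * (g a + B / A)"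
  proof (rule abs_cont_on_nonincreasing[OF ab abs_cont_on_mult[OF E G] N])
    fix t assume "t \<in> {a<..<b} - N"
    then obtain d where d: "(g has_real_derivative d) (at t within {a..b})" "d \<le> A * g t + B" using der by blast
    have E': "((\<lambda>t. exp (- A * t)) has_real_derivative exp (- A * t) * (- A)) (at t within {a..b})"
      by (auto intro!: derivative_eq_intros)
    have "((\<lambda>t. exp (- A * t) * (g t + B / A)) has_real_derivative exp (- A * t) * (d - A * g t - B)) (at t within {a..b})"
    proof (rule DERIV_cong[OF DERIV_mult[OF E' DERIV_add[OF d(1) DERIV_const]]])
      show "exp (- A * t) * (- A) * (g t + B / A) + (d + 0) * exp (- A * t) = exp (- A * t) * (d - A * g t - B)"
        using A by (simp add: algebra_simps)
    qed
    then show "\<exists>d\<le>0. ((\<lambda>t. exp (- A * t) * (g t + B / A)) has_real_derivative d) (at t within {a..b})"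
      using d(2) by (intro exI[of _ "exp (- A * t) * (d - A * g t - B)"]) (auto intro: mult_nonneg_nonpos)
  qed
  then have "exp (A * b) * (exp (- A * b) * (g b + B / A)) \<le> exp (A * b) * (exp (- A * a) * (g a + B / A))"
    by (intro mult_left_mono) auto
  moreover have "exp (A * b) * (exp (- A * b) * (g b + B / A)) = g b + B / A"
  proof -
    have "exp (A * b) * exp (- A * b) = 1" by (simp add: exp_add[symmetric])
    then show ?thesis by (metis mult.assoc mult_1)
  qed
  moreover have "exp (A * b) * (exp (- A * a) * (g a + B / A)) = exp (A * (b - a)) * (g a + B / A)"
  proof -
    have "exp (A * b) * exp (- A * a) = exp (A * (b - a))" by (simp add: exp_add[symmetric] right_diff_distrib)
    then show ?thesis by (metis mult.assoc)
  qed
  ultimately have "g b + B / A \<le> exp (A * (b - a)) * (g a + B / A)" by metis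
  moreover have "exp (A * (b - a)) * (g a + B / A) = exp (A * (b - a)) * g a + B * (exp (A * (b - a)) - 1) / A + B / A"
    using A by (simp add: field_simps)
  ultimately show ?thesis by linarith
qed

section \<open>Tangent and normal cones under the constraint qualification\<close>

text \<open>\<open>grad\<close> is a definite description, so it can be used only once the
  representing vector is known to exist and to be unique.\<close>

lemma GDERIV_grad:
  fixes g :: "'a::euclidean_space \<Rightarrow> real"
  assumes "g differentiable (at x)"
  shows "GDERIV g x :> grad g x"
proof -
  obtain g' where g': "(g has_derivative g') (at x)" using assms by (auto simp: differentiable_def)
  then interpret g': bounded_linear g' by (rule has_derivative_bounded_linear)
  define D where "D = (\<Sum>b\<in>Basis. g' b *\<^sub>R b)"
  have "g' h = h \<bullet> D" for h
  proof -
    have "g' h = g' (\<Sum>b\<in>Basis. (h \<bullet> b) *\<^sub>R b)" by (simp add: euclidean_representation)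
    also have "\<dots> = h \<bullet> D" by (simp add: D_def g'.sum g'.scale inner_sum_right mult.commute)
    finally show ?thesis .
  qed
  then have "g' = (\<lambda>h. h \<bullet> D)" by (rule ext)
  then have D: "GDERIV g x :> D" using g' by (simp add: gderiv_def)
  moreover have "D' = D" if "GDERIV g x :> D'" for D'
  proof -
    have "(\<lambda>h. h \<bullet> D') = (\<lambda>h. h \<bullet> D)"
      using that D unfolding gderiv_def by (rule has_derivative_unique)
    then show ?thesis by (meson vector_eq_ldot)
  qed
  ultimately show ?thesis unfolding grad_def by (rule theI)
qed

lemma C11_continuous_grad:
  fixes g :: "'a::euclidean_space \<Rightarrow> real"
  assumes "C11 g"
  shows "continuous_on UNIV (grad g)"
  unfolding continuous_on_eq_continuous_at[OF open_UNIV]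
proof
  fix x :: 'a
  obtain e L where "e > 0" "L-lipschitz_on (ball x e) (grad g)"
    using assms unfolding C11_def by metis
  then show "continuous (at x) (grad g)"
    using lipschitz_on_continuous_on continuous_on_eq_continuous_at[OF open_ball] centre_in_ball by blast
qed

text \<open>The vector is the normalized negative of the point of the convex hull of the \<open>g i\<close> that is closest to the origin.\<close>

lemma exists_common_descent_direction:
  fixes g :: "'i \<Rightarrow> 'a::euclidean_space"
  assumes fin: "finite I" and "b \<ge> 0"
    and low: "\<And>l. I \<noteq> {} \<Longrightarrow> (\<And>i. i \<in> I \<Longrightarrow> l i \<ge> 0) \<Longrightarrow> sum l I = 1 \<Longrightarrow> norm (\<Sum>i\<in>I. l i *\<^sub>R g i) > b"
  obtains v where "norm v \<le> 1" "\<And>i. i \<in> I \<Longrightarrow> g i \<bullet> v < - b"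
proof (cases "I = {}")
  case True
  then show ?thesis using that[of 0] by simp
next
  case ne: False
  define H where "H = convex hull (g ` I)"
  have H: "closed H" "convex H" "H \<noteq> {}"
    using fin ne by (auto simp: H_def finite_imp_compact_convex_hull compact_imp_closed)
  define z where "z = closest_point H 0"
  have z: "z \<in> H" unfolding z_def using H by (intro closest_point_in_set)
  \<comment> \<open>The weights of a convex combination belong to points, while \<open>g\<close> may
    take one value at several indices: a single representative index receives the weight of the
    point, all others receive 0.\<close>
  obtain J where J: "J \<subseteq> I" "inj_on g J" "g ` I = g ` J" using subset_image_inj[of "g ` I" g I] by blast
  obtain u where u: "\<And>x. x \<in> g ` I \<Longrightarrow> 0 \<le> u x" "sum u (g ` I) = 1" "(\<Sum>x\<in>g ` I. u x *\<^sub>R x) = z"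
    using z fin by (auto simp: H_def convex_hull_finite)
  define l where "l i = (if i \<in> J then u (g i) else 0)" for i
  have "sum l I = sum (u \<circ> g) J"
    using J fin by (intro sum.mono_neutral_cong_right) (auto simp: l_def)
  then have l1: "sum l I = 1" using u(2) J by (simp add: sum.reindex)
  have "(\<Sum>i\<in>I. l i *\<^sub>R g i) = sum ((\<lambda>x. u x *\<^sub>R x) \<circ> g) J"
    using J fin by (intro sum.mono_neutral_cong_right) (auto simp: l_def)
  then have "(\<Sum>i\<in>I. l i *\<^sub>R g i) = z" using u(3) J by (simp add: sum.reindex)
  then have nz: "norm z > b" using low[OF ne _ l1] u(1) by (auto simp: l_def)
  show ?thesis
  proof (rule that[of "- sgn z"])
    fix i assume "i \<in> I"
    then have "(0 - z) \<bullet> (g i - z) \<le> 0"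
      unfolding z_def using H by (intro closest_point_dot) (auto simp: H_def hull_inc)
    then have "norm z * norm z \<le> g i \<bullet> z"
      by (simp add: inner_diff_right inner_commute norm_eq_sqrt_inner flip: power2_eq_square)
    moreover have "norm z > 0" using nz \<open>b \<ge> 0\<close> by linarith
    ultimately have "norm z \<le> (g i \<bullet> z) / norm z" by (simp only: pos_le_divide_eq)
    then show "g i \<bullet> (- sgn z) < - b" using nz by (simp add: sgn_div_norm field_simps)
  qed (simp add: norm_sgn)
qed

locale qualified_constraints =
  fixes r :: nat and \<psi> :: "nat \<Rightarrow> 'a::euclidean_space \<Rightarrow> real" and C :: "'a set" and \<eta> :: real
  assumes C_eq: "C = feasible_set r \<psi>" and compact_C: "compact C" and \<eta>_pos: "\<eta> > 0"
    and C11: "\<And>i. i \<in> {1..r} \<Longrightarrow> C11 (\<psi> i)"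
    and qualification: "\<And>c l. active r \<psi> c \<noteq> {} \<Longrightarrow> (\<And>i. i \<in> active r \<psi> c \<Longrightarrow> l i \<ge> 0) \<Longrightarrow>
      (\<Sum>i\<in>active r \<psi> c. l i) = 1 \<Longrightarrow> norm (\<Sum>i\<in>active r \<psi> c. l i *\<^sub>R grad (\<psi> i) c) > 2 * \<eta>"
begin

lemma mem_C_iff: "z \<in> C \<longleftrightarrow> (\<forall>i\<in>{1..r}. \<psi> i z \<le> 0)"
  by (simp add: C_eq feasible_set_def sublevel_def)

lemma active_subset: "active r \<psi> c \<subseteq> {1..r}"
  by (auto simp: active_def)

lemma finite_active: "finite (active r \<psi> c)"
  by (rule finite_subset[OF active_subset]) simp

lemma grad_deriv: "i \<in> {1..r} \<Longrightarrow> GDERIV (\<psi> i) z :> grad (\<psi> i) z"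
  using C11[of i] by (intro GDERIV_grad) (simp add: C11_def)

lemma grad_cont: "i \<in> {1..r} \<Longrightarrow> continuous_on UNIV (grad (\<psi> i))"
  using C11 by (intro C11_continuous_grad)

lemma tendsto_grad: "i \<in> {1..r} \<Longrightarrow> (f \<longlongrightarrow> c) F \<Longrightarrow> ((\<lambda>t. grad (\<psi> i) (f t)) \<longlongrightarrow> grad (\<psi> i) c) F"
  using continuous_on_tendsto_compose[OF grad_cont, of i f c F] by simp

lemma tendsto_psi: "i \<in> {1..r} \<Longrightarrow> (f \<longlongrightarrow> c) F \<Longrightarrow> ((\<lambda>t. \<psi> i (f t)) \<longlongrightarrow> \<psi> i c) F"
  using has_derivative_continuous[OF grad_deriv[unfolded gderiv_def], of i c] by (simp add: isCont_tendsto_compose)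

lemma psi_line_deriv:
  assumes "i \<in> {1..r}"
  shows "((\<lambda>s. \<psi> i (y + s *\<^sub>R d)) has_real_derivative (d \<bullet> grad (\<psi> i) (y + s *\<^sub>R d))) (at s within S)"
proof (rule GDERIV_compose_vector_derivative[OF grad_deriv[OF assms]])
  show "((\<lambda>s. y + s *\<^sub>R d) has_vector_derivative d) (at s within S)"
    by (auto intro!: derivative_eq_intros simp: has_vector_derivative_def)
qed

lemma psi_mean_value:
  assumes i: "i \<in> {1..r}" and "s > 0"
  obtains \<theta> where "0 < \<theta>" "\<theta> < s" "\<psi> i (y + s *\<^sub>R d) - \<psi> i y = s * (d \<bullet> grad (\<psi> i) (y + \<theta> *\<^sub>R d))"
proof -
  have "\<exists>\<theta>>0. \<theta> < s \<and> \<psi> i (y + s *\<^sub>R d) - \<psi> i (y + 0 *\<^sub>R d) = (s - 0) * (d \<bullet> grad (\<psi> i) (y + \<theta> *\<^sub>R d))"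
    by (rule MVT2[OF \<open>s > 0\<close>]) (rule psi_line_deriv[OF i])
  then show ?thesis using that by auto
qed

text \<open>A Mangasarian-Fromovitz form of the qualification with an explicit rate: one vector
  serves all active constraints at once. The cone and penalty estimates use the qualification in
  this form.\<close>

lemma descent_direction:
  obtains v where "norm v \<le> 1" "\<And>i. i \<in> active r \<psi> c \<Longrightarrow> grad (\<psi> i) c \<bullet> v < - (2 * \<eta>)"
  by (rule exists_common_descent_direction[OF finite_active, of "2 * \<eta>" c "\<lambda>i. grad (\<psi> i) c"])
    (use qualification \<eta>_pos in auto)

text \<open>Near \<open>c\<close> the gradient of an active constraint still has a negative product
  with \<open>d\<close>, so the mean value theorem on the segment starting at \<open>y j\<close>
  preserves feasibility; inactive constraints stay negative by continuity.\<close>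

lemma eventually_feasible:
  fixes y :: "nat \<Rightarrow> 'a"
  assumes y: "\<And>j. y j \<in> C" "y \<longlonglongrightarrow> c" and \<tau>: "\<And>j. 0 < \<tau> j" "\<tau> \<longlonglongrightarrow> 0" and "c \<in> C"
    and d: "\<And>i. i \<in> active r \<psi> c \<Longrightarrow> grad (\<psi> i) c \<bullet> d < 0"
  shows "\<forall>\<^sub>F j in sequentially. y j + \<tau> j *\<^sub>R d \<in> C"
proof -
  have "(\<lambda>j. y j + \<tau> j *\<^sub>R d) \<longlonglongrightarrow> c + 0 *\<^sub>R d" by (intro tendsto_intros y \<tau>)
  then have lim: "(\<lambda>j. y j + \<tau> j *\<^sub>R d) \<longlonglongrightarrow> c" by simp
  have "\<forall>\<^sub>F j in sequentially. \<psi> i (y j + \<tau> j *\<^sub>R d) \<le> 0" if i: "i \<in> {1..r}" for i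
  proof (cases "i \<in> active r \<psi> c")
    case True
    have "\<forall>\<^sub>F z in nhds c. grad (\<psi> i) z \<bullet> d < 0"
      using tendsto_inner[OF tendsto_grad[OF i filterlim_ident] tendsto_const, of d c] d[OF True]
      by (intro order_tendstoD(2))
    then obtain \<rho> where \<rho>: "\<rho> > 0" "\<And>z. dist z c < \<rho> \<Longrightarrow> grad (\<psi> i) z \<bullet> d < 0"
      unfolding eventually_nhds_metric by blast
    have "\<forall>\<^sub>F j in sequentially. dist (y j) c < \<rho> \<and> dist (y j + \<tau> j *\<^sub>R d) c < \<rho>"
      using tendstoD[OF y(2) \<rho>(1)] tendstoD[OF lim \<rho>(1)] by (rule eventually_conj)
    then show ?thesis
    proof eventually_elim
      fix j assume j: "dist (y j) c < \<rho> \<and> dist (y j + \<tau> j *\<^sub>R d) c < \<rho>"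
      obtain \<theta> where \<theta>: "0 < \<theta>" "\<theta> < \<tau> j"
        "\<psi> i (y j + \<tau> j *\<^sub>R d) - \<psi> i (y j) = \<tau> j * (d \<bullet> grad (\<psi> i) (y j + \<theta> *\<^sub>R d))"
        using psi_mean_value[OF i \<tau>(1)] by blast
      have "y j + \<theta> *\<^sub>R d = (1 - \<theta> / \<tau> j) *\<^sub>R y j + (\<theta> / \<tau> j) *\<^sub>R (y j + \<tau> j *\<^sub>R d)"
        using \<tau>(1)[of j] by (simp add: algebra_simps)
      also have "\<dots> \<in> ball c \<rho>"
        using j \<theta> \<tau>(1)[of j] by (intro convexD_alt convex_ball) (auto simp: dist_commute)
      finally have "grad (\<psi> i) (y j + \<theta> *\<^sub>R d) \<bullet> d < 0" by (intro \<rho>(2)) (simp add: dist_commute)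
      then have "\<tau> j * (d \<bullet> grad (\<psi> i) (y j + \<theta> *\<^sub>R d)) < 0"
        using \<tau>(1)[of j] by (simp add: inner_commute mult_pos_neg)
      moreover have "\<psi> i (y j) \<le> 0" using y(1) i by (simp add: mem_C_iff)
      ultimately show "\<psi> i (y j + \<tau> j *\<^sub>R d) \<le> 0" using \<theta>(3) by linarith
    qed
  next
    case False
    then have "\<psi> i c < 0" using i \<open>c \<in> C\<close> by (force simp: active_def mem_C_iff)
    then have "\<forall>\<^sub>F j in sequentially. \<psi> i (y j + \<tau> j *\<^sub>R d) < 0"
      by (rule order_tendstoD(2)[OF tendsto_psi[OF i lim]])
    then show ?thesis by eventually_elim simp
  qed
  then show ?thesis by (simp add: mem_C_iff eventually_ball_finite)
qed

text \<open>Tilting a linearized direction slightly towards the common descent direction makes all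
  active inequalities strict, and strict directions are admissible from every nearby feasible point.
  This closes the gap between the linearized cone and Clarke's cone.\<close>

lemma clarke_tangent_cone_eq:
  assumes c: "c \<in> C"
  shows "clarke_tangent_cone C c = {v. \<forall>i\<in>active r \<psi> c. grad (\<psi> i) c \<bullet> v \<le> 0}"
proof (intro equalityI subsetI; clarify)
  fix v i assume v: "v \<in> clarke_tangent_cone C c" and act: "i \<in> active r \<psi> c"
  then have i: "i \<in> {1..r}" "\<psi> i c = 0" by (auto simp: active_def)
  \<comment> \<open>The constant sequence at \<open>c\<close> is a sufficient test for this
    inclusion; the term \<open>e * norm v\<close> below is the remainder of the first-order
    expansion.\<close>
  have "(\<lambda>j. 1 / real (Suc j)) \<longlonglongrightarrow> 0" by (rule LIMSEQ_Suc[OF lim_1_over_n])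
  then have "\<exists>w. w \<longlonglongrightarrow> v \<and> (\<forall>j. c + (1 / real (Suc j)) *\<^sub>R w j \<in> C)"
    using v c unfolding clarke_tangent_cone_def mem_Collect_eq
    by (elim conjE allE[of _ "\<lambda>_. c"] allE[of _ "\<lambda>j. 1 / real (Suc j)"]) simp
  then obtain w where w: "w \<longlonglongrightarrow> v" "\<And>j. c + (1 / real (Suc j)) *\<^sub>R w j \<in> C" by blast
  have "grad (\<psi> i) c \<bullet> v \<le> 0 + e * norm v" if "e > 0" for e
  proof (rule tendsto_le[OF sequentially_bot tendsto_add[OF tendsto_const tendsto_mult[OF tendsto_const tendsto_norm[OF w(1)]]]
        tendsto_inner[OF tendsto_const w(1)]])
    have "(\<psi> i has_derivative (\<lambda>h. h \<bullet> grad (\<psi> i) c)) (at c)"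
      using grad_deriv[OF i(1)] by (simp add: gderiv_def)
    then obtain \<delta> where \<delta>: "\<delta> > 0" "\<And>z. norm (z - c) < \<delta> \<Longrightarrow>
        norm (\<psi> i z - \<psi> i c - (z - c) \<bullet> grad (\<psi> i) c) \<le> e * norm (z - c)"
      using \<open>e > 0\<close> unfolding has_derivative_at_alt by blast
    have "(\<lambda>j. (1 / real (Suc j)) *\<^sub>R w j) \<longlonglongrightarrow> 0 *\<^sub>R v"
      by (intro tendsto_scaleR LIMSEQ_Suc[OF lim_1_over_n] w(1))
    then have "\<forall>\<^sub>F j in sequentially. norm ((1 / real (Suc j)) *\<^sub>R w j) < \<delta>"
      using tendstoD[OF _ \<delta>(1)] by fastforce
    then show "\<forall>\<^sub>F j in sequentially. grad (\<psi> i) c \<bullet> w j \<le> 0 + e * norm (w j)"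
    proof eventually_elim
      fix j
      define s where "s = 1 / real (Suc j)"
      have s: "s > 0" by (simp add: s_def)
      assume "norm ((1 / real (Suc j)) *\<^sub>R w j) < \<delta>"
      then have "\<bar>\<psi> i (c + s *\<^sub>R w j) - s * (w j \<bullet> grad (\<psi> i) c)\<bar> \<le> e * (s * norm (w j))"
        using \<delta>(2)[of "c + s *\<^sub>R w j"] i(2) s unfolding s_def[symmetric] by simp
      moreover have "\<psi> i (c + s *\<^sub>R w j) \<le> 0" using w(2)[of j] i(1) by (simp add: mem_C_iff s_def)
      ultimately have "s * (w j \<bullet> grad (\<psi> i) c) \<le> s * (e * norm (w j))"
        using i(2) by (simp add: mult.left_commute abs_le_iff)
      then show "grad (\<psi> i) c \<bullet> w j \<le> 0 + e * norm (w j)"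
        using s by (simp add: inner_commute)
    qed
  qed
  then have "grad (\<psi> i) c \<bullet> v \<le> 0 + e" if "e > 0" for e
  proof -
    have "grad (\<psi> i) c \<bullet> v \<le> (e / (norm v + 1)) * norm v"
      using \<open>\<And>e. e > 0 \<Longrightarrow> grad (\<psi> i) c \<bullet> v \<le> 0 + e * norm v\<close>[of "e / (norm v + 1)"] that
      by (simp add: add_nonneg_pos)
    also have "\<dots> = e * (norm v / (norm v + 1))" by simp
    also have "\<dots> \<le> e" using that by (intro mult_left_le) (auto simp: add_nonneg_pos)
    finally show ?thesis by simp
  qed
  then show "grad (\<psi> i) c \<bullet> v \<le> 0" by (rule field_le_epsilon)
next
  fix v assume v: "\<forall>i\<in>active r \<psi> c. grad (\<psi> i) c \<bullet> v \<le> 0"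
  obtain v0 where v0: "norm v0 \<le> 1" "\<And>i. i \<in> active r \<psi> c \<Longrightarrow> grad (\<psi> i) c \<bullet> v0 < - (2 * \<eta>)"
    using descent_direction[of c] by blast
  show "v \<in> clarke_tangent_cone C c"
    unfolding clarke_tangent_cone_def
  proof (clarify, intro conjI c allI impI)
    fix y :: "nat \<Rightarrow> 'a" and \<tau> :: "nat \<Rightarrow> real"
    assume h: "(\<forall>j. y j \<in> C) \<and> y \<longlonglongrightarrow> c \<and> (\<forall>j. 0 < \<tau> j) \<and> \<tau> \<longlonglongrightarrow> 0"
    define D where "D j = {w. y j + \<tau> j *\<^sub>R w \<in> C}" for j
    \<comment> \<open>Taking the admissible direction nearest to \<open>v\<close> gives one sequence
      that works for every \<open>e\<close>; the tilted direction, which depends on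
      \<open>e\<close>, enters only as a competitor in the distance.\<close>
    define w where "w j = closest_point (D j) v" for j
    have D: "closed (D j)" "D j \<noteq> {}" for j
    proof -
      have "D j = (\<lambda>w. y j + \<tau> j *\<^sub>R w) -` C" by (auto simp: D_def)
      then show "closed (D j)"
        using compact_imp_closed[OF compact_C] by (auto intro!: continuous_closed_vimage continuous_intros)
      have "0 \<in> D j" using h by (simp add: D_def)
      then show "D j \<noteq> {}" by blast
    qed
    have "w \<longlonglongrightarrow> v"
    proof (rule tendstoI)
      fix e :: real assume e: "e > 0"
      have "\<forall>\<^sub>F j in sequentially. y j + \<tau> j *\<^sub>R (v + (e / 2) *\<^sub>R v0) \<in> C"
      proof (rule eventually_feasible[OF _ _ _ _ c])
        fix i assume i: "i \<in> active r \<psi> c"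
        have "(e / 2) * (grad (\<psi> i) c \<bullet> v0) < 0"
          using v0(2)[OF i] e \<eta>_pos by (intro mult_pos_neg) auto
        then show "grad (\<psi> i) c \<bullet> (v + (e / 2) *\<^sub>R v0) < 0"
          using v i by (simp add: inner_add_right add_nonpos_neg)
      qed (use h in auto)
      then show "\<forall>\<^sub>F j in sequentially. dist (w j) v < e"
      proof eventually_elim
        fix j assume "y j + \<tau> j *\<^sub>R (v + (e / 2) *\<^sub>R v0) \<in> C"
        then have "dist v (w j) \<le> dist v (v + (e / 2) *\<^sub>R v0)"
          unfolding w_def using D by (intro closest_point_le) (auto simp: D_def)
        also have "\<dots> \<le> e / 2" using v0(1) e by (simp add: dist_norm mult_left_le)
        finally show "dist (w j) v < e" using e by (simp add: dist_commute)
      qed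
    qed
    moreover have "y j + \<tau> j *\<^sub>R w j \<in> C" for j
      using closest_point_in_set[OF D, of j v] by (simp add: w_def D_def)
    ultimately show "\<exists>w. w \<longlonglongrightarrow> v \<and> (\<forall>j. y j + \<tau> j *\<^sub>R w j \<in> C)" by blast
  qed
qed

section \<open>Quadratic estimates for the constraints and for normal vectors\<close>

text \<open>On the segment, which stays in the convex hull, the gradient changes by at most
  \<open>2 * m * s * norm h\<close>; integration over \<open>s\<close> halves the constant. The
  correction in \<open>k\<close> makes its derivative nonnegative.\<close>

lemma psi_lower_bound:
  assumes i: "i \<in> {1..r}" and lip: "(2 * m)-lipschitz_on (convex hull C) (grad (\<psi> i))"
    and a: "a \<in> C" and b: "b \<in> C"
  shows "\<psi> i a + grad (\<psi> i) a \<bullet> (b - a) - m * (norm (b - a))\<^sup>2 \<le> \<psi> i b"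
proof -
  define h where "h = b - a"
  define k where "k s = \<psi> i (a + s *\<^sub>R h) - s * (grad (\<psi> i) a \<bullet> h) + m * s\<^sup>2 * (norm h)\<^sup>2" for s :: real
  have "k 0 \<le> k 1"
  proof (rule DERIV_nonneg_imp_nondecreasing[of 0 1 k])
    fix s :: real assume s: "0 \<le> s" "s \<le> 1"
    have "a + s *\<^sub>R h = (1 - s) *\<^sub>R a + s *\<^sub>R b" by (simp add: h_def algebra_simps)
    also have "\<dots> \<in> convex hull C"
      using s a b by (intro convexD_alt convex_convex_hull) (auto intro: hull_inc)
    finally have "dist (grad (\<psi> i) (a + s *\<^sub>R h)) (grad (\<psi> i) a) \<le> 2 * m * dist (a + s *\<^sub>R h) a"
      using lipschitz_onD[OF lip] a by (simp add: hull_inc)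
    then have "norm (grad (\<psi> i) (a + s *\<^sub>R h) - grad (\<psi> i) a) \<le> 2 * m * (s * norm h)"
      using s by (simp add: dist_norm)
    then have "norm h * norm (grad (\<psi> i) (a + s *\<^sub>R h) - grad (\<psi> i) a) \<le> norm h * (2 * m * (s * norm h))"
      by (intro mult_left_mono) auto
    then have "\<bar>h \<bullet> (grad (\<psi> i) (a + s *\<^sub>R h) - grad (\<psi> i) a)\<bar> \<le> 2 * m * s * (norm h)\<^sup>2"
      using Cauchy_Schwarz_ineq2[of h "grad (\<psi> i) (a + s *\<^sub>R h) - grad (\<psi> i) a"]
      by (simp add: power2_eq_square mult_ac)
    then have "0 \<le> h \<bullet> grad (\<psi> i) (a + s *\<^sub>R h) - grad (\<psi> i) a \<bullet> h + 2 * m * s * (norm h)\<^sup>2"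
      by (simp add: inner_diff_right inner_commute abs_le_iff)
    moreover have "(k has_real_derivative h \<bullet> grad (\<psi> i) (a + s *\<^sub>R h) - grad (\<psi> i) a \<bullet> h + 2 * m * s * (norm h)\<^sup>2) (at s)"
      unfolding k_def by (rule derivative_eq_intros psi_line_deriv[OF i] refl | simp)+
    ultimately show "\<exists>y. (k has_real_derivative y) (at s) \<and> 0 \<le> y" by blast
  qed simp
  then show ?thesis by (simp add: k_def h_def)
qed

text \<open>The hypomonotonicity of the normal cone of a possibly nonconvex \<open>C\<close>. The
  chord \<open>y - c\<close> misses the tangent cone by a quadratic error; a push of size
  \<open>s\<close> along the common descent direction repairs this and costs at most
  \<open>s * norm \<zeta>\<close>.\<close>

lemma normal_cone_bound:
  assumes lip: "\<And>i. i \<in> {1..r} \<Longrightarrow> (2 * m)-lipschitz_on (convex hull C) (grad (\<psi> i))"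
    and c: "c \<in> C" and y: "y \<in> C" and \<zeta>: "\<zeta> \<in> clarke_normal_cone C c" and m: "m \<ge> 0"
  shows "\<zeta> \<bullet> (y - c) \<le> m / (2 * \<eta>) * norm \<zeta> * (norm (y - c))\<^sup>2"
proof -
  obtain v where v: "norm v \<le> 1" "\<And>i. i \<in> active r \<psi> c \<Longrightarrow> grad (\<psi> i) c \<bullet> v < - (2 * \<eta>)"
    using descent_direction[of c] by blast
  \<comment> \<open>The quadratic error \<open>m * (norm (y - c))\<^sup>2\<close> divided by the
    descent rate \<open>2 * \<eta>\<close>.\<close>
  define s where "s = m / (2 * \<eta>) * (norm (y - c))\<^sup>2"
  have s: "s \<ge> 0" using m \<eta>_pos by (simp add: s_def)
  have "y - c + s *\<^sub>R v \<in> clarke_tangent_cone C c"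
    unfolding clarke_tangent_cone_eq[OF c] mem_Collect_eq
  proof
    fix i assume act: "i \<in> active r \<psi> c"
    then have i: "i \<in> {1..r}" "\<psi> i c = 0" by (auto simp: active_def)
    have "s * (grad (\<psi> i) c \<bullet> v) \<le> s * (- (2 * \<eta>))" using less_imp_le[OF v(2)[OF act]] s by (intro mult_left_mono) auto
    moreover have "s * (- (2 * \<eta>)) = - (m * (norm (y - c))\<^sup>2)" using \<eta>_pos by (simp add: s_def)
    ultimately show "grad (\<psi> i) c \<bullet> (y - c + s *\<^sub>R v) \<le> 0"
    proof -
      have "\<psi> i y \<le> 0" using y i(1) by (simp add: mem_C_iff)
      moreover have "grad (\<psi> i) c \<bullet> (y - c + s *\<^sub>R v) = grad (\<psi> i) c \<bullet> (y - c) + s * (grad (\<psi> i) c \<bullet> v)"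
        by (simp add: inner_add_right)
      ultimately show ?thesis
        using psi_lower_bound[OF i(1) lip[OF i(1)] c y] i(2) \<open>s * (grad (\<psi> i) c \<bullet> v) \<le> s * (- (2 * \<eta>))\<close>
          \<open>s * (- (2 * \<eta>)) = - (m * (norm (y - c))\<^sup>2)\<close> by linarith
    qed
  qed
  then have "\<zeta> \<bullet> (y - c + s *\<^sub>R v) \<le> 0" using \<zeta> by (auto simp: clarke_normal_cone_def)
  moreover have "- (\<zeta> \<bullet> v) \<le> norm \<zeta>"
    using Cauchy_Schwarz_ineq2[of \<zeta> v] mult_left_le[OF v(1) norm_ge_zero[of \<zeta>]] by simp
  then have "s * - (\<zeta> \<bullet> v) \<le> s * norm \<zeta>" using s by (rule mult_left_mono)
  ultimately have "\<zeta> \<bullet> (y - c) \<le> s * norm \<zeta>" by (simp add: inner_add_right)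
  then show ?thesis by (simp add: s_def mult_ac)
qed

text \<open>Along a trajectory in \<open>C\<close> every active constraint attains a maximum, so the velocity and its
  negative both lie in the tangent cone.\<close>

lemma normal_cone_orthogonal_velocity:
  assumes x: "(x has_vector_derivative v) (at t)" and "t \<in> S" "open S" and inC: "\<And>s. s \<in> S \<Longrightarrow> x s \<in> C"
    and \<zeta>: "\<zeta> \<in> clarke_normal_cone C (x t)"
  shows "\<zeta> \<bullet> v = 0"
proof -
  have "grad (\<psi> i) (x t) \<bullet> v = 0" if act: "i \<in> active r \<psi> (x t)" for i
  proof -
    have i: "i \<in> {1..r}" "\<psi> i (x t) = 0" using act by (auto simp: active_def)
    have "((\<lambda>s. \<psi> i (x s)) has_derivative (*) (v \<bullet> grad (\<psi> i) (x t))) (at t)"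
      using GDERIV_compose_vector_derivative[OF grad_deriv[OF i(1)] x] by (simp add: has_field_derivative_def)
    from differential_zero_maxmin[OF assms(2,3) this] have "(*) (v \<bullet> grad (\<psi> i) (x t)) = (\<lambda>v. 0)"
      using inC i by (auto simp: mem_C_iff)
    then have "v \<bullet> grad (\<psi> i) (x t) * 1 = 0" by (rule fun_cong)
    then show ?thesis by (simp add: inner_commute)
  qed
  then have "v \<in> clarke_tangent_cone C (x t)" "- v \<in> clarke_tangent_cone C (x t)"
    using inC[OF assms(2)] by (simp_all add: clarke_tangent_cone_eq)
  then have "\<zeta> \<bullet> v \<le> 0" "\<zeta> \<bullet> (- v) \<le> 0" using \<zeta> by (auto simp: clarke_normal_cone_def)
  then show ?thesis by simp
qed

section \<open>The inward direction at boundary points\<close>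

text \<open>Every projection lies in the tangent cone, so none has a positive product with an active
  gradient. The projection of \<open>- grad (\<psi> i) c\<close> has a strictly negative one with
  \<open>grad (\<psi> i) c\<close>: otherwise it would be 0, and the descent direction would violate
  the variational inequality of the projection.\<close>

lemma inward_direction_descent:
  assumes c: "c \<in> C" and act: "i \<in> active r \<psi> c"
  shows "grad (\<psi> i) c \<bullet> inward_direction r \<psi> c < 0"
proof -
  define K where "K = clarke_tangent_cone C c"
  have K: "K = {v. \<forall>i\<in>active r \<psi> c. grad (\<psi> i) c \<bullet> v \<le> 0}" using c by (simp add: K_def clarke_tangent_cone_eq)
  have "K = (\<Inter>i\<in>active r \<psi> c. {v. grad (\<psi> i) c \<bullet> v \<le> 0})" by (auto simp: K)
  then have cK: "closed K" by (simp add: closed_halfspace_le closed_INT)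
  have "convex K" unfolding K convex_alt
    by (auto simp: inner_add_right intro!: add_nonpos_nonpos mult_nonneg_nonpos)
  define p where "p j = closest_point K (- grad (\<psi> j) c)" for j
  have "0 \<in> K" by (simp add: K)
  have pK: "p j \<in> K" for j unfolding p_def using cK \<open>0 \<in> K\<close> by (intro closest_point_in_set) auto
  obtain v where v: "norm v \<le> 1" "\<And>i. i \<in> active r \<psi> c \<Longrightarrow> grad (\<psi> i) c \<bullet> v < - (2 * \<eta>)"
    using descent_direction[of c] by blast
  have neg: "grad (\<psi> i) c \<bullet> p i < 0"
  proof (rule ccontr)
    assume "\<not> grad (\<psi> i) c \<bullet> p i < 0"
    then have 0: "grad (\<psi> i) c \<bullet> p i = 0" using pK[of i] act by (force simp: K)
    have "(- grad (\<psi> i) c - p i) \<bullet> (0 - p i) \<le> 0"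
      unfolding p_def using cK \<open>convex K\<close> \<open>0 \<in> K\<close> by (intro closest_point_dot)
    then have "p i \<bullet> p i \<le> 0" using 0 by (simp add: inner_diff_left)
    then have p0: "p i = 0" by (metis inner_eq_zero_iff inner_ge_zero order_antisym)
    have "v \<in> K" using v(2) \<eta>_pos by (force simp: K)
    then have "(- grad (\<psi> i) c - p i) \<bullet> (v - p i) \<le> 0"
      unfolding p_def using cK \<open>convex K\<close> by (intro closest_point_dot)
    then show False using p0 v(2)[OF act] \<eta>_pos by simp
  qed
  have "inward_direction r \<psi> c = (\<Sum>j\<in>active r \<psi> c. p j)"
    by (simp add: inward_direction_def p_def K_def C_eq)
  then have "grad (\<psi> i) c \<bullet> inward_direction r \<psi> c = grad (\<psi> i) c \<bullet> p i + (\<Sum>j\<in>active r \<psi> c - {i}. grad (\<psi> i) c \<bullet> p j)"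
    using act finite_active by (simp add: inner_sum_right inner_add_right sum.remove)
  moreover have "(\<Sum>j\<in>active r \<psi> c - {i}. grad (\<psi> i) c \<bullet> p j) \<le> 0"
    using pK act by (intro sum_nonpos) (auto simp: K)
  ultimately show ?thesis using neg by simp
qed

text \<open>An active constraint would attain a local maximum there, so its gradient would vanish,
  against the qualification.\<close>

lemma active_interior:
  assumes c: "c \<in> interior C"
  shows "active r \<psi> c = {}"
proof (rule ccontr)
  assume ne: "active r \<psi> c \<noteq> {}"
  then obtain i where act: "i \<in> active r \<psi> c" by blast
  then have i: "i \<in> {1..r}" "\<psi> i c = 0" by (auto simp: active_def)
  have "(\<psi> i has_derivative (\<lambda>h. h \<bullet> grad (\<psi> i) c)) (at c)"
    using grad_deriv[OF i(1)] by (simp add: gderiv_def)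
  from differential_zero_maxmin[OF c open_interior this]
  have *: "(\<lambda>h. h \<bullet> grad (\<psi> i) c) = (\<lambda>h. 0)"
    using i interior_subset[of C] unfolding subset_iff mem_C_iff by metis
  have "grad (\<psi> i) c \<bullet> grad (\<psi> i) c = 0" by (rule fun_cong[OF *])
  then have "grad (\<psi> i) c = 0" by simp
  obtain v where "grad (\<psi> i) c \<bullet> v < - (2 * \<eta>)" using descent_direction[of c] act by metis
  then show False using \<open>grad (\<psi> i) c = 0\<close> \<eta>_pos by simp
qed

subsection \<open>The exponential penalty\<close>

text \<open>The quotient \<open>ln (exp_sum \<gamma> z) / \<gamma>\<close> is the log-sum-exp
  smoothing of the maximum of the \<open>\<psi> i z\<close>, and \<open>penalty_force\<close> is the
  gradient of \<open>exp_sum\<close>.\<close>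

definition exp_sum :: "real \<Rightarrow> 'a \<Rightarrow> real" where
  "exp_sum \<gamma> z = (\<Sum>i=1..r. exp (\<gamma> * \<psi> i z))"

definition penalty_force :: "real \<Rightarrow> 'a \<Rightarrow> 'a" where
  "penalty_force \<gamma> z = (\<Sum>i=1..r. (\<gamma> * exp (\<gamma> * \<psi> i z)) *\<^sub>R grad (\<psi> i) z)"

lemma exp_sum_pos: "r \<ge> 1 \<Longrightarrow> exp_sum \<gamma> z > 0"
  unfolding exp_sum_def by (intro sum_pos) auto

lemma exp_le_exp_sum: "i \<in> {1..r} \<Longrightarrow> exp (\<gamma> * \<psi> i z) \<le> exp_sum \<gamma> z"
  unfolding exp_sum_def by (intro member_le_sum) auto

lemma exp_sum_less_1:
  assumes "exp_sum \<gamma> z < 1" "\<gamma> > 0"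
  shows "z \<in> C"
  unfolding mem_C_iff
proof
  fix i assume "i \<in> {1..r}"
  then have "exp (\<gamma> * \<psi> i z) < 1" using exp_le_exp_sum[of i \<gamma> z] assms(1) by linarith
  then have "\<gamma> * \<psi> i z < 0" by simp
  then show "\<psi> i z \<le> 0" using assms(2) by (simp add: mult_less_0_iff)
qed

lemma exp_sum_deriv: "GDERIV (exp_sum \<gamma>) z :> penalty_force \<gamma> z"
  unfolding gderiv_def exp_sum_def penalty_force_def inner_sum_right
proof (rule has_derivative_sum)
  fix i assume "i \<in> {1..r}"
  have "GDERIV (\<lambda>z. exp (\<gamma> * \<psi> i z)) z :> (\<gamma> * exp (\<gamma> * \<psi> i z)) *\<^sub>R grad (\<psi> i) z"
    by (rule GDERIV_DERIV_compose[OF grad_deriv[OF \<open>i \<in> {1..r}\<close>]]) (auto intro!: derivative_eq_intros)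
  then show "((\<lambda>z. exp (\<gamma> * \<psi> i z)) has_derivative (\<lambda>h. h \<bullet> ((\<gamma> * exp (\<gamma> * \<psi> i z)) *\<^sub>R grad (\<psi> i) z))) (at z)"
    by (simp add: gderiv_def)
qed

lemma psi_cont: "i \<in> {1..r} \<Longrightarrow> continuous_on UNIV (\<psi> i)"
  unfolding continuous_on_def by (intro ballI tendsto_psi tendsto_ident_at)

lemma exp_sum_cont: "continuous_on UNIV (exp_sum \<gamma>)"
  unfolding exp_sum_def by (intro continuous_intros psi_cont)

lemma ln_exp_sum_deriv:
  assumes "r \<ge> 1"
  shows "GDERIV (\<lambda>z. ln (exp_sum \<gamma> z)) z :> (1 / exp_sum \<gamma> z) *\<^sub>R penalty_force \<gamma> z"
  using exp_sum_pos[OF assms] by (intro GDERIV_DERIV_compose[OF exp_sum_deriv]) (auto intro!: derivative_eq_intros)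

lemma ln_exp_sum_deriv_cont:
  assumes "r \<ge> 1"
  shows "continuous_on UNIV (\<lambda>z. (1 / exp_sum \<gamma> z) *\<^sub>R penalty_force \<gamma> z)"
  unfolding penalty_force_def
  by (intro continuous_intros psi_cont grad_cont exp_sum_cont) (use exp_sum_pos[OF assms, of \<gamma>] in \<open>auto simp: less_imp_neq[symmetric]\<close>)

text \<open>Near \<open>c\<close>, each constraint inactive at \<open>c\<close> has weight at most
  \<open>exp (- (\<gamma> * \<delta>))\<close>, which is negligible against
  \<open>\<kappa> / \<gamma>\<close>. The active ones thus govern the force, and testing with the
  common descent direction bounds its norm from below.\<close>

lemma penalty_force_lower_bound_local:
  assumes "\<kappa> > 0" and "c \<in> C"
  obtains N where "open N" "c \<in> N"
    "\<forall>\<^sub>F \<gamma> in at_top. \<forall>z\<in>N. exp_sum \<gamma> z > \<kappa> / \<gamma> \<longrightarrow> 2 * \<eta> * \<gamma> * exp_sum \<gamma> z \<le> norm (penalty_force \<gamma> z)"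
proof -
  obtain v where v: "norm v \<le> 1" "\<And>i. i \<in> active r \<psi> c \<Longrightarrow> grad (\<psi> i) c \<bullet> v < - (2 * \<eta>)"
    using descent_direction[of c] by blast
  have "\<forall>\<^sub>F \<mu> in at_right (2 * \<eta>). grad (\<psi> i) c \<bullet> v < - \<mu>" if "i \<in> active r \<psi> c" for i
    by (rule order_tendstoD(1)[OF tendsto_minus[OF tendsto_ident_at] v(2)[OF that]])
  then have "\<forall>\<^sub>F \<mu> in at_right (2 * \<eta>). (\<forall>i\<in>active r \<psi> c. grad (\<psi> i) c \<bullet> v < - \<mu>) \<and> 2 * \<eta> < \<mu>"
    by (intro eventually_conj eventually_ball_finite finite_active eventually_at_right_less) auto
  \<comment> \<open>The strict inequality of the descent direction leaves room for a
    \<open>\<mu>\<close> above \<open>2 * \<eta>\<close>; the margin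
    \<open>\<mu> - 2 * \<eta>\<close> absorbs the inactive terms, so the rate
    \<open>2 * \<eta>\<close> itself survives.\<close>
  then obtain \<mu> where \<mu>: "\<And>i. i \<in> active r \<psi> c \<Longrightarrow> grad (\<psi> i) c \<bullet> v < - \<mu>" "2 * \<eta> < \<mu>"
    using eventually_happens'[OF trivial_limit_at_right_real] by blast
  have "\<forall>\<^sub>F \<delta> in at_right 0. \<psi> i c < - \<delta>" if "i \<in> {1..r} - active r \<psi> c" for i
  proof (rule order_tendstoD(1)[of uminus])
    show "(uminus \<longlongrightarrow> - (0::real)) (at_right 0)" by (rule tendsto_minus[OF tendsto_ident_at])
    show "\<psi> i c < - 0" using that \<open>c \<in> C\<close> by (force simp: active_def mem_C_iff)
  qed
  then have "\<forall>\<^sub>F \<delta> in at_right 0. (\<forall>i\<in>{1..r} - active r \<psi> c. \<psi> i c < - \<delta>) \<and> (0::real) < \<delta>"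
    by (intro eventually_conj eventually_ball_finite eventually_at_right_less) auto
  then obtain \<delta> :: real where \<delta>: "\<And>i. i \<in> {1..r} - active r \<psi> c \<Longrightarrow> \<psi> i c < - \<delta>" "0 < \<delta>"
    using eventually_happens'[OF trivial_limit_at_right_real] by blast
  define G where "G = (\<Sum>i=1..r. norm (grad (\<psi> i) c)) + 1"
  have "\<forall>\<^sub>F z in nhds c. norm (grad (\<psi> i) z) < G \<and>
      (if i \<in> active r \<psi> c then grad (\<psi> i) z \<bullet> v < - \<mu> else \<psi> i z < - \<delta>)" if i: "i \<in> {1..r}" for i
  proof (intro eventually_conj)
    note g = tendsto_grad[OF i filterlim_ident, of c]
    have "norm (grad (\<psi> i) c) \<le> (\<Sum>i=1..r. norm (grad (\<psi> i) c))" using i by (intro member_le_sum) auto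
    then show "\<forall>\<^sub>F z in nhds c. norm (grad (\<psi> i) z) < G"
      by (intro order_tendstoD(2)[OF tendsto_norm[OF g]]) (simp add: G_def)
    show "\<forall>\<^sub>F z in nhds c. if i \<in> active r \<psi> c then grad (\<psi> i) z \<bullet> v < - \<mu> else \<psi> i z < - \<delta>"
    proof (cases "i \<in> active r \<psi> c")
      case True
      then show ?thesis
        using order_tendstoD(2)[OF tendsto_inner[OF g tendsto_const] \<mu>(1)] by simp
    next
      case False
      then show ?thesis
        using order_tendstoD(2)[OF tendsto_psi[OF i filterlim_ident] \<delta>(1)] i by simp
    qed
  qed
  then have "\<forall>\<^sub>F z in nhds c. \<forall>i\<in>{1..r}. norm (grad (\<psi> i) z) < G \<and>
      (if i \<in> active r \<psi> c then grad (\<psi> i) z \<bullet> v < - \<mu> else \<psi> i z < - \<delta>)"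
    by (intro eventually_ball_finite) auto
  then obtain N where N: "open N" "c \<in> N" "\<And>z i. z \<in> N \<Longrightarrow> i \<in> {1..r} \<Longrightarrow> norm (grad (\<psi> i) z) < G \<and>
      (if i \<in> active r \<psi> c then grad (\<psi> i) z \<bullet> v < - \<mu> else \<psi> i z < - \<delta>)"
    unfolding eventually_nhds by blast
  have "((\<lambda>\<gamma>. real r * (exp (- (\<gamma> * \<delta>)) * (G + \<mu>)) * \<gamma>) \<longlongrightarrow> 0) at_top"
    using \<delta>(2) by real_asymp
  moreover have "0 < (\<mu> - 2 * \<eta>) * \<kappa>" using \<mu>(2) \<open>\<kappa> > 0\<close> by simp
  ultimately have "\<forall>\<^sub>F \<gamma> in at_top. real r * (exp (- (\<gamma> * \<delta>)) * (G + \<mu>)) * \<gamma> < (\<mu> - 2 * \<eta>) * \<kappa>"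
    by (rule order_tendstoD(2))
  then have "\<forall>\<^sub>F \<gamma> in at_top. \<forall>z\<in>N. exp_sum \<gamma> z > \<kappa> / \<gamma> \<longrightarrow> 2 * \<eta> * \<gamma> * exp_sum \<gamma> z \<le> norm (penalty_force \<gamma> z)"
    using eventually_gt_at_top[of 0]
  proof (eventually_elim, intro ballI impI)
    fix \<gamma> z
    assume \<gamma>: "real r * (exp (- (\<gamma> * \<delta>)) * (G + \<mu>)) * \<gamma> < (\<mu> - 2 * \<eta>) * \<kappa>" "0 < \<gamma>"
      and z: "z \<in> N" "\<kappa> / \<gamma> < exp_sum \<gamma> z"
    let ?e = "\<lambda>i. exp (\<gamma> * \<psi> i z)"
    let ?E = "exp (- (\<gamma> * \<delta>)) * (G + \<mu>)"
    have G: "G \<ge> 0" "\<mu> > 0" using \<mu>(2) \<eta>_pos by (simp_all add: G_def sum_nonneg)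
    have "penalty_force \<gamma> z \<bullet> v = (\<Sum>i=1..r. \<gamma> * ?e i * (grad (\<psi> i) z \<bullet> v))"
      by (simp add: penalty_force_def inner_sum_left)
    also have "\<dots> \<le> (\<Sum>i=1..r. \<gamma> * (?E - \<mu> * ?e i))"
    proof (rule sum_mono)
      fix i assume i: "i \<in> {1..r}"
      \<comment> \<open>One bound for both kinds of index: for an inactive one, \<open>?E\<close>
        covers the product with the gradient together with the \<open>\<mu> * ?e i\<close> that is
        subtracted anyway.\<close>
      have "?e i * (grad (\<psi> i) z \<bullet> v) \<le> ?E - \<mu> * ?e i"
      proof (cases "i \<in> active r \<psi> c")
        case True
        then have "?e i * (grad (\<psi> i) z \<bullet> v) \<le> ?e i * (- \<mu>)"
          using N(3)[OF z(1) i] by (intro mult_left_mono) auto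
        moreover have "?E \<ge> 0" using G by simp
        ultimately show ?thesis by (simp add: mult.commute)
      next
        case False
        then have "\<psi> i z < - \<delta>" using N(3)[OF z(1) i] by simp
        then have "\<gamma> * \<psi> i z \<le> \<gamma> * (- \<delta>)" using \<gamma>(2) by (intro mult_left_mono) auto
        then have "?e i * (G + \<mu>) \<le> ?E" using G by (intro mult_right_mono) auto
        moreover have "?e i * (grad (\<psi> i) z \<bullet> v) \<le> ?e i * G"
        proof (rule mult_left_mono)
          show "grad (\<psi> i) z \<bullet> v \<le> G"
            using N(3)[OF z(1) i] Cauchy_Schwarz_ineq2[of "grad (\<psi> i) z" v]
              mult_left_le[OF v(1) norm_ge_zero[of "grad (\<psi> i) z"]] by linarith
        qed simp
        ultimately show ?thesis unfolding distrib_left mult.commute[of \<mu>] by linarith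
      qed
      then show "\<gamma> * ?e i * (grad (\<psi> i) z \<bullet> v) \<le> \<gamma> * (?E - \<mu> * ?e i)"
        using \<gamma>(2) by (simp add: mult.assoc)
    qed
    also have "\<dots> = real r * ?E * \<gamma> - \<mu> * \<gamma> * exp_sum \<gamma> z"
      by (simp add: exp_sum_def sum_subtractf sum_distrib_left right_diff_distrib mult_ac)
    also have "\<dots> \<le> (\<mu> - 2 * \<eta>) * (\<gamma> * exp_sum \<gamma> z) - \<mu> * \<gamma> * exp_sum \<gamma> z"
    proof -
      have "\<kappa> \<le> \<gamma> * exp_sum \<gamma> z" using z(2) \<gamma>(2) by (simp add: field_simps)
      then have "(\<mu> - 2 * \<eta>) * \<kappa> \<le> (\<mu> - 2 * \<eta>) * (\<gamma> * exp_sum \<gamma> z)"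
        using \<mu>(2) by (intro mult_left_mono) auto
      then show ?thesis using \<gamma>(1) by linarith
    qed
    also have "\<dots> = - (2 * \<eta> * \<gamma> * exp_sum \<gamma> z)" by (simp add: algebra_simps)
    finally show "2 * \<eta> * \<gamma> * exp_sum \<gamma> z \<le> norm (penalty_force \<gamma> z)"
      using Cauchy_Schwarz_ineq2[of "penalty_force \<gamma> z" v] mult_left_le[OF v(1) norm_ge_zero[of "penalty_force \<gamma> z"]]
      by linarith
  qed
  then show thesis using N(1,2) by (intro that)
qed

text \<open>Finitely many of the local neighbourhoods cover the compact \<open>C\<close>, so one
  threshold for \<open>\<gamma>\<close> serves all points.\<close>

lemma penalty_force_lower_bound:
  assumes "\<kappa> > 0"
  shows "\<forall>\<^sub>F \<gamma> in at_top. \<forall>z\<in>C. exp_sum \<gamma> z > \<kappa> / \<gamma> \<longrightarrow> 2 * \<eta> * \<gamma> * exp_sum \<gamma> z \<le> norm (penalty_force \<gamma> z)"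
    (is "\<forall>\<^sub>F \<gamma> in at_top. \<forall>z\<in>C. ?P \<gamma> z")
proof -
  define \<N> where "\<N> = {N. open N \<and> (\<forall>\<^sub>F \<gamma> in at_top. \<forall>z\<in>N. ?P \<gamma> z)}"
  have "C \<subseteq> \<Union>\<N>"
  proof
    fix c assume c: "c \<in> C"
    obtain N where "open N" "c \<in> N" "\<forall>\<^sub>F \<gamma> in at_top. \<forall>z\<in>N. ?P \<gamma> z"
      using penalty_force_lower_bound_local[OF assms c] by blast
    then show "c \<in> \<Union>\<N>" by (auto simp: \<N>_def)
  qed
  then obtain \<N>' where \<N>': "\<N>' \<subseteq> \<N>" "finite \<N>'" "C \<subseteq> \<Union>\<N>'"
    by (rule compactE[OF compact_C]) (simp add: \<N>_def)
  have "\<forall>\<^sub>F \<gamma> in at_top. \<forall>N\<in>\<N>'. \<forall>z\<in>N. ?P \<gamma> z"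
    using \<N>'(1,2) unfolding \<N>_def by (intro eventually_ball_finite) blast+
  then show ?thesis
  proof eventually_elim
    fix \<gamma> assume "\<forall>N\<in>\<N>'. \<forall>z\<in>N. ?P \<gamma> z"
    then show "\<forall>z\<in>C. ?P \<gamma> z" using \<N>'(3) by (meson UnionE subsetD)
  qed
qed

lemma norm_initial_point_diff:
  assumes "s \<ge> 0"
  shows "norm (initial_point r \<psi> c s - c) \<le> s"
  using assms by (simp add: initial_point_def)

text \<open>A step of length \<open>\<sigma>\<close> brings every constraint below
  \<open>- (\<kappa> * \<sigma>)\<close>, so the sum is at most
  \<open>r * exp (- (\<kappa> * (\<gamma> * s \<gamma>)))\<close>, which tends to 0. Only the bound
  1 is recorded: it places the initial point in \<open>C\<close>, whatever the size of
  \<open>\<kappa>\<close>.\<close>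

lemma exp_sum_initial_point:
  assumes c: "c \<in> C" and lim: "filterlim s (at_right 0) F" and lim': "filterlim (\<lambda>\<gamma>. \<gamma> * s \<gamma>) at_top F"
    and F: "F \<le> at_top"
  shows "\<forall>\<^sub>F \<gamma> in F. exp_sum \<gamma> (initial_point r \<psi> c (s \<gamma>)) < 1"
proof -
  \<comment> \<open>The value 0 encodes the unshifted interior case; no constraint is active there,
    so the sign condition on \<open>d\<close> is vacuous.\<close>
  define d where "d = (if c \<in> interior C then 0 else sgn (inward_direction r \<psi> c))"
  have ip: "initial_point r \<psi> c \<sigma> = c + \<sigma> *\<^sub>R d" for \<sigma>
    by (simp add: initial_point_def d_def sgn_div_norm C_eq divide_inverse)
  have d: "grad (\<psi> i) c \<bullet> d < 0" if "i \<in> active r \<psi> c" for i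
  proof -
    have ni: "c \<notin> interior C" using active_interior[of c] that by blast
    have neg: "grad (\<psi> i) c \<bullet> inward_direction r \<psi> c < 0" using inward_direction_descent[OF c that] .
    then have "inverse (norm (inward_direction r \<psi> c)) > 0" by (cases "inward_direction r \<psi> c = 0") simp_all
    then have "inverse (norm (inward_direction r \<psi> c)) * (grad (\<psi> i) c \<bullet> inward_direction r \<psi> c) < 0"
      using neg by (rule mult_pos_neg)
    then show ?thesis using ni by (simp add: d_def sgn_div_norm del: mult_less_0_iff)
  qed
  have "\<forall>\<^sub>F \<kappa> in at_right 0. grad (\<psi> i) c \<bullet> d < - \<kappa>" if "i \<in> active r \<psi> c" for i
  proof (rule order_tendstoD(1)[of uminus])
    show "(uminus \<longlongrightarrow> - (0::real)) (at_right 0)" by (rule tendsto_minus[OF tendsto_ident_at])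
  qed (use d that in simp)
  then have "\<forall>\<^sub>F \<kappa> in at_right 0. (\<forall>i\<in>active r \<psi> c. grad (\<psi> i) c \<bullet> d < - \<kappa>) \<and> (0::real) < \<kappa>"
    by (intro eventually_conj eventually_ball_finite finite_active eventually_at_right_less) auto
  then obtain \<kappa> :: real where \<kappa>: "\<And>i. i \<in> active r \<psi> c \<Longrightarrow> grad (\<psi> i) c \<bullet> d < - \<kappa>" "0 < \<kappa>"
    using eventually_happens'[OF trivial_limit_at_right_real] by blast
  have "((\<lambda>\<sigma>::real. c + \<sigma> *\<^sub>R d) \<longlongrightarrow> c + 0 *\<^sub>R d) (at_right 0)"
    by (rule tendsto_add[OF tendsto_const tendsto_scaleR[OF tendsto_ident_at tendsto_const]])
  then have line: "((\<lambda>\<sigma>::real. c + \<sigma> *\<^sub>R d) \<longlongrightarrow> c) (at_right 0)" by simp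
  have "\<forall>\<^sub>F \<sigma> in at_right 0. \<psi> i (c + \<sigma> *\<^sub>R d) \<le> - (\<kappa> * \<sigma>)" if i: "i \<in> {1..r}" for i
  proof (cases "i \<in> active r \<psi> c")
    case True
    have "\<forall>\<^sub>F \<sigma> in at_right 0. grad (\<psi> i) (c + \<sigma> *\<^sub>R d) \<bullet> d < - \<kappa>"
      by (rule order_tendstoD(2)[OF tendsto_inner[OF tendsto_grad[OF i line] tendsto_const] \<kappa>(1)[OF True]])
    then obtain b where b: "b > 0" "\<And>\<theta>. 0 < \<theta> \<Longrightarrow> \<theta> < b \<Longrightarrow> grad (\<psi> i) (c + \<theta> *\<^sub>R d) \<bullet> d < - \<kappa>"
      unfolding eventually_at_right_field by blast
    have "\<psi> i (c + \<sigma> *\<^sub>R d) \<le> - (\<kappa> * \<sigma>)" if \<sigma>: "0 < \<sigma>" "\<sigma> < b" for \<sigma>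
    proof -
      obtain \<theta> where \<theta>: "0 < \<theta>" "\<theta> < \<sigma>" "\<psi> i (c + \<sigma> *\<^sub>R d) - \<psi> i c = \<sigma> * (d \<bullet> grad (\<psi> i) (c + \<theta> *\<^sub>R d))"
        using psi_mean_value[OF i \<sigma>(1)] by blast
      have "\<sigma> * (d \<bullet> grad (\<psi> i) (c + \<theta> *\<^sub>R d)) \<le> \<sigma> * (- \<kappa>)"
        using b(2)[of \<theta>] \<theta>(1,2) \<sigma> by (intro mult_left_mono) (auto simp: inner_commute)
      then show ?thesis using \<theta>(3) True by (simp add: active_def mult.commute)
    qed
    then show ?thesis using b(1) unfolding eventually_at_right_field by blast
  next
    case False
    have "((\<lambda>\<sigma>. \<psi> i (c + \<sigma> *\<^sub>R d) + \<kappa> * \<sigma>) \<longlongrightarrow> \<psi> i c + \<kappa> * 0) (at_right 0)"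
      by (rule tendsto_add[OF tendsto_psi[OF i line] tendsto_mult[OF tendsto_const tendsto_ident_at]])
    moreover have "\<psi> i c < 0" using False i c by (force simp: active_def mem_C_iff)
    ultimately have "\<forall>\<^sub>F \<sigma> in at_right 0. \<psi> i (c + \<sigma> *\<^sub>R d) + \<kappa> * \<sigma> < 0"
      using order_tendstoD(2) by fastforce
    then show ?thesis by eventually_elim simp
  qed
  then have "\<forall>\<^sub>F \<sigma> in at_right 0. \<forall>i\<in>{1..r}. \<psi> i (c + \<sigma> *\<^sub>R d) \<le> - (\<kappa> * \<sigma>)"
    by (intro eventually_ball_finite) auto
  then have ev: "\<forall>\<^sub>F \<gamma> in F. \<forall>i\<in>{1..r}. \<psi> i (initial_point r \<psi> c (s \<gamma>)) \<le> - (\<kappa> * s \<gamma>)"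
    unfolding ip using lim by (rule eventually_compose_filterlim)
  have "((\<lambda>t. real r * exp (- (\<kappa> * t))) \<longlongrightarrow> 0) at_top" using \<kappa>(2) by real_asymp
  then have "((\<lambda>\<gamma>. real r * exp (- (\<kappa> * (\<gamma> * s \<gamma>)))) \<longlongrightarrow> 0) F" using lim' by (rule filterlim_compose)
  then have "\<forall>\<^sub>F \<gamma> in F. real r * exp (- (\<kappa> * (\<gamma> * s \<gamma>))) < 1" by (rule order_tendstoD(2)) simp
  moreover have "\<forall>\<^sub>F \<gamma> in F. 0 < \<gamma>" using F eventually_gt_at_top[of "0::real"] unfolding le_filter_def by blast
  ultimately show ?thesis using ev
  proof eventually_elim
    fix \<gamma> assume h: "real r * exp (- (\<kappa> * (\<gamma> * s \<gamma>))) < 1" "0 < \<gamma>"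
      "\<forall>i\<in>{1..r}. \<psi> i (initial_point r \<psi> c (s \<gamma>)) \<le> - (\<kappa> * s \<gamma>)"
    have "exp_sum \<gamma> (initial_point r \<psi> c (s \<gamma>)) \<le> (\<Sum>i=1..r. exp (- (\<kappa> * (\<gamma> * s \<gamma>))))"
      unfolding exp_sum_def
    proof (rule sum_mono)
      fix i assume "i \<in> {1..r}"
      then have "\<gamma> * \<psi> i (initial_point r \<psi> c (s \<gamma>)) \<le> \<gamma> * (- (\<kappa> * s \<gamma>))"
        using h(2,3) by (intro mult_left_mono) auto
      then show "exp (\<gamma> * \<psi> i (initial_point r \<psi> c (s \<gamma>))) \<le> exp (- (\<kappa> * (\<gamma> * s \<gamma>)))"
        by (simp add: mult_ac)
    qed
    then show "exp_sum \<gamma> (initial_point r \<psi> c (s \<gamma>)) < 1" using h(1) by simp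
  qed
qed

end

section \<open>Distance between the two trajectories\<close>

lemma AE_lebesgue_on_negligible:
  assumes "AE t in lebesgue_on S. P t" "S \<in> sets lebesgue"
  obtains N where "negligible N" "\<And>t. t \<in> S - N \<Longrightarrow> P t"
proof -
  have "AE t in lebesgue. t \<in> S \<longrightarrow> P t" using assms by (simp add: AE_restrict_space_iff)
  then obtain N where "negligible N" "{t. \<not> (t \<in> S \<longrightarrow> P t)} \<subseteq> N"
    unfolding eventually_ae_filter_negligible by blast
  then show thesis by (intro that[of N]) auto
qed

text \<open>The times with \<open>x t\<close> outside \<open>S\<close> form a relatively open set.
  If it contained any time, even an endpoint, it would contain a nonempty open set of interior
  times, which is not negligible.\<close>

lemma closed_everywhere_if_almost_everywhere:
  fixes x :: "real \<Rightarrow> 'a::metric_space"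
  assumes ab: "a < b" and x: "continuous_on {a..b} x" and "closed S" and N: "negligible N"
    and ae: "\<And>t. t \<in> {a..b} - N \<Longrightarrow> x t \<in> S" and t: "t \<in> {a..b}"
  shows "x t \<in> S"
proof (rule ccontr)
  assume nt: "x t \<notin> S"
  have "openin (top_of_set {a..b}) ({a..b} \<inter> x -` (- S))"
    using continuous_openin_preimage_gen[OF x, of "- S"] \<open>closed S\<close> by (simp add: open_Compl)
  then obtain V where V: "open V" "{a..b} \<inter> x -` (- S) = {a..b} \<inter> V" by (auto simp: openin_open)
  have tV: "t \<in> V" using V(2) t nt by blast
  have "V \<inter> {a<..<b} \<noteq> {}"
  proof
    assume emp: "V \<inter> {a<..<b} = {}"
    have "closure {a<..<b} = {a..b}" using ab by simp
    then show False using open_Int_closure_eq_empty[OF V(1), of "{a<..<b}"] emp tV t by auto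
  qed
  moreover have "V \<inter> {a<..<b} \<subseteq> N"
  proof
    fix s assume s: "s \<in> V \<inter> {a<..<b}"
    then have "s \<in> {a..b} \<inter> x -` (- S)" using V(2) by auto
    then show "s \<in> N" using ae[of s] s by auto
  qed
  ultimately show False
    using open_not_negligible[of "V \<inter> {a<..<b}"] V(1) negligible_subset[OF N] by (auto simp: open_Int)
qed

text \<open>The function \<open>- p * ln p\<close> increases up to \<open>exp (- 1)\<close>. The
  inequality \<open>ln z \<le> z - 1\<close> at \<open>z = c / p\<close> replaces the derivative,
  and \<open>c \<le> exp (- 1)\<close> enters as \<open>- ln c \<ge> 1\<close>.\<close>

lemma entropy_bound:
  fixes p c :: real
  assumes "0 < p" "p \<le> c" "c \<le> exp (- 1)"
  shows "p * (- ln p) \<le> c * (- ln c)"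
proof -
  have c: "0 < c" using assms by simp
  have "ln (c / p) \<le> c / p - 1" using c assms(1) by (intro ln_le_minus_one) simp
  then have "p * (ln c - ln p) \<le> p * (c / p - 1)"
    using c assms(1) by (simp add: ln_div)
  also have "\<dots> = c - p" using assms(1) by (simp add: algebra_simps)
  finally have *: "p * (ln c - ln p) \<le> c - p" .
  have "ln c \<le> ln (exp (- 1))" using c assms(3) by (subst ln_le_cancel_iff) auto
  then have "(c - p) * 1 \<le> (c - p) * (- ln c)" using assms(2) by (intro mult_left_mono) auto
  then show ?thesis using * by (simp add: algebra_simps)
qed

text \<open>\<open>x\<close> is the sweeping and \<open>y\<close> the penalized trajectory;
  \<open>p\<close> and \<open>q\<close> stand for the values of \<open>f\<close> at
  \<open>y t\<close> and \<open>x t\<close> under the same control. The dynamics are assumed only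
  while \<open>y t\<close> lies in \<open>C\<close>, where \<open>f\<close> is bounded by
  \<open>M\<close>; that \<open>y\<close> stays in \<open>C\<close> is derived below.\<close>

locale trajectory_pair = qualified_constraints r \<psi> C \<eta>
  for r :: nat and \<psi> :: "nat \<Rightarrow> 'a::euclidean_space \<Rightarrow> real" and C :: "'a set" and \<eta> :: real +
  fixes T M m \<gamma> :: real and x y :: "real \<Rightarrow> 'a" and N :: "real set"
  assumes T_pos: "T > 0" and M_pos: "M > 0" and m_pos: "m > 0" and r_pos: "r \<ge> 1"
    and lip: "\<And>i. i \<in> {1..r} \<Longrightarrow> (2 * m)-lipschitz_on (convex hull C) (grad (\<psi> i))"
    and \<gamma>_large: "exp 1 * M \<le> \<eta> * \<gamma>"
    and force_large: "\<And>z. z \<in> C \<Longrightarrow> exp_sum \<gamma> z > M / (\<eta> * \<gamma>) \<Longrightarrow> 2 * \<eta> * \<gamma> * exp_sum \<gamma> z \<le> norm (penalty_force \<gamma> z)"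
    and x_ac: "abs_cont_on 0 T x" and y_ac: "abs_cont_on 0 T y"
    and x_in: "\<And>t. t \<in> {0..T} \<Longrightarrow> x t \<in> C" and y0: "exp_sum \<gamma> (y 0) < 1"
    and N: "negligible N"
    and dynamics: "\<And>t. t \<in> {0<..<T} - N \<Longrightarrow> y t \<in> C \<Longrightarrow>
      \<exists>p q \<zeta>. (y has_vector_derivative p - penalty_force \<gamma> (y t)) (at t within {0..T}) \<and>
        (x has_vector_derivative q - \<zeta>) (at t within {0..T}) \<and> \<zeta> \<in> clarke_normal_cone C (x t) \<and>
        norm p \<le> M \<and> norm q \<le> M \<and> norm (p - q) \<le> M * norm (y t - x t)"
begin

text \<open>The value of the sum at which the lower bound \<open>2 * \<eta> * \<gamma> * c0\<close>
  on the force equals \<open>2 * M\<close>, twice the bound on \<open>f\<close>.\<close>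

definition c0 :: real where "c0 = M / (\<eta> * \<gamma>)"

text \<open>A Lyapunov function for the layer, unrelated to the control set of the theorem. Thanks
  to the logarithm it decreases at a rate at least \<open>\<eta> * \<gamma>\<close> times the norm
  of the force, however small the sum is above \<open>c0\<close>.\<close>

definition U :: "real \<Rightarrow> real" where "U t = ln (exp_sum \<gamma> (y t))"

lemma \<gamma>_pos: "\<gamma> > 0"
proof -
  have "0 < exp 1 * M" using M_pos by simp
  then have "0 < \<eta> * \<gamma>" using \<gamma>_large by linarith
  then show ?thesis using \<eta>_pos by (simp add: zero_less_mult_iff)
qed

lemma c0_pos: "c0 > 0"
  using M_pos \<eta>_pos \<gamma>_pos by (simp add: c0_def)

lemma c0_le: "c0 \<le> exp (- 1)"
  using \<gamma>_large \<eta>_pos \<gamma>_pos by (simp add: c0_def exp_minus field_simps)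

lemma ln_c0_less: "ln c0 < 0"
proof -
  have "c0 < 1" using c0_le by (rule le_less_trans) simp
  then show ?thesis using c0_pos by simp
qed

lemma U_ac: "abs_cont_on 0 T U"
  unfolding U_def by (rule abs_cont_on_gradient[OF y_ac ln_exp_sum_deriv[OF r_pos] ln_exp_sum_deriv_cont[OF r_pos]])

lemma U_neg_in_C:
  assumes "U t < 0"
  shows "y t \<in> C"
  using assms exp_sum_pos[OF r_pos, of \<gamma> "y t"] \<gamma>_pos by (intro exp_sum_less_1[of \<gamma>]) (auto simp: U_def)

lemma c0_less_exp_sum_iff: "c0 < exp_sum \<gamma> (y t) \<longleftrightarrow> ln c0 < U t"
  using exp_sum_pos[OF r_pos, of \<gamma> "y t"] c0_pos by (simp add: U_def)

text \<open>The normal vector is orthogonal to the velocity \<open>q - \<zeta>\<close>, so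
  \<open>(norm \<zeta>)\<^sup>2 = \<zeta> \<bullet> q\<close>: it is no longer than
  \<open>q\<close>.\<close>

lemma normal_vector_bound:
  assumes t: "t \<in> {0<..<T}" and x': "(x has_vector_derivative q - \<zeta>) (at t within {0..T})"
    and \<zeta>: "\<zeta> \<in> clarke_normal_cone C (x t)" and q: "norm q \<le> M"
  shows "norm \<zeta> \<le> M"
proof -
  have "(x has_vector_derivative q - \<zeta>) (at t)"
    using x' t by (simp add: at_within_Icc_at)
  then have "\<zeta> \<bullet> (q - \<zeta>) = 0"
    using t x_in \<zeta> by (intro normal_cone_orthogonal_velocity[of x _ t "{0<..<T}"]) auto
  then have "norm \<zeta> * norm \<zeta> = \<zeta> \<bullet> q" by (simp add: inner_diff_right dot_square_norm power2_eq_square)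
  also have "\<dots> \<le> norm \<zeta> * norm q" using norm_cauchy_schwarz .
  also have "\<dots> \<le> norm \<zeta> * M" using q by (intro mult_left_mono) auto
  finally show ?thesis using M_pos by (cases "\<zeta> = 0") auto
qed

section \<open>The initial layer\<close>

text \<open>Above \<open>c0\<close> the force \<open>F\<close> has norm at least
  \<open>2 * M\<close>. The relative speed is then at most
  \<open>3 * M + norm F \<le> 5 / 2 * norm F\<close>, while
  \<open>(p - F) \<bullet> F \<le> - (norm F)\<^sup>2 / 2\<close>; dividing by the sum and using
  \<open>force_large\<close> gives \<open>d \<le> - (\<eta> * \<gamma> * norm F)\<close>. The factor
  5 compares the two.\<close>

lemma layer_derivatives:
  assumes t: "t \<in> {0<..<T} - N" and U: "ln c0 < U t" "U t < 0"
  obtains v d where "((\<lambda>t. y t - x t) has_vector_derivative v) (at t within {0..T})"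
    "(U has_real_derivative d) (at t within {0..T})" "d \<le> 0" "2 * \<eta> * \<gamma> * norm v \<le> - 5 * d"
proof -
  have yC: "y t \<in> C" using U(2) by (rule U_neg_in_C)
  obtain p q \<zeta> where D: "(y has_vector_derivative p - penalty_force \<gamma> (y t)) (at t within {0..T})"
      "(x has_vector_derivative q - \<zeta>) (at t within {0..T})" "\<zeta> \<in> clarke_normal_cone C (x t)"
      "norm p \<le> M" "norm q \<le> M"
    using dynamics[OF t yC] by blast
  define F where "F = penalty_force \<gamma> (y t)"
  define V where "V = exp_sum \<gamma> (y t)"
  have V: "V > 0" "c0 < V" using exp_sum_pos[OF r_pos] U(1) by (auto simp: V_def c0_less_exp_sum_iff)
  have \<zeta>: "norm \<zeta> \<le> M" using normal_vector_bound[OF _ D(2,3,5)] t by blast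
  have F: "2 * \<eta> * \<gamma> * V \<le> norm F"
    using force_large[OF yC] V(2) by (simp add: V_def F_def c0_def)
  have "2 * M = 2 * \<eta> * \<gamma> * c0" using \<eta>_pos \<gamma>_pos by (simp add: c0_def)
  also have "\<dots> \<le> 2 * \<eta> * \<gamma> * V" using V \<eta>_pos \<gamma>_pos by simp
  finally have FM: "2 * M \<le> norm F" using F by linarith
  define v where "v = (p - F) - (q - \<zeta>)"
  define d where "d = (p - F) \<bullet> ((1 / V) *\<^sub>R F)"
  have "norm v \<le> norm p + norm F + (norm q + norm \<zeta>)"
    unfolding v_def by (meson add_mono norm_triangle_ineq4 order_trans)
  also have "\<dots> \<le> 5 / 2 * norm F" using D(4,5) \<zeta> FM by linarith
  finally have v: "norm v \<le> 5 / 2 * norm F" .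
  have "p \<bullet> F \<le> norm p * norm F" by (rule norm_cauchy_schwarz)
  also have "\<dots> \<le> norm F / 2 * norm F" using D(4) FM by (intro mult_right_mono) auto
  finally have "(p - F) \<bullet> F \<le> - (norm F * norm F / 2)"
    by (simp add: inner_diff_left dot_square_norm power2_eq_square)
  then have "(p - F) \<bullet> F / V \<le> - (norm F * norm F / 2) / V" using V(1) by (intro divide_right_mono) auto
  also have "norm F * (2 * \<eta> * \<gamma> * V) \<le> norm F * norm F" using F by (intro mult_left_mono) auto
  then have "- (norm F * norm F / 2) / V \<le> - (\<eta> * \<gamma> * norm F)" using V(1) by (simp add: field_simps)
  finally have d: "d \<le> - (\<eta> * \<gamma> * norm F)" by (simp add: d_def)
  show thesis
  proof (rule that[of v d])
    show "((\<lambda>t. y t - x t) has_vector_derivative v) (at t within {0..T})"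
      unfolding v_def F_def by (rule has_vector_derivative_diff[OF D(1,2)])
    show "(U has_real_derivative d) (at t within {0..T})"
      unfolding U_def d_def F_def V_def
      by (rule GDERIV_compose_vector_derivative[OF ln_exp_sum_deriv[OF r_pos] D(1)])
    have "\<eta> * \<gamma> * norm F \<ge> 0" using \<eta>_pos \<gamma>_pos by simp
    then show "d \<le> 0" using d by linarith
    have "2 * \<eta> * \<gamma> * norm v \<le> 2 * \<eta> * \<gamma> * (5 / 2 * norm F)" using v \<eta>_pos \<gamma>_pos by (intro mult_left_mono) auto
    then show "2 * \<eta> * \<gamma> * norm v \<le> - 5 * d" using d by linarith
  qed
qed

text \<open>Started at time 0, a barrier keeps \<open>y\<close> in \<open>C\<close>; at the level
  \<open>ln c0\<close>, it makes the end of the layer final.\<close>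

lemma U_barrier:
  assumes "s \<in> {0..T}" "U s \<le> c" "ln c0 \<le> c" "c < 0" "t \<in> {s..T}"
  shows "U t \<le> c"
proof (rule abs_cont_on_barrier[where g = U and t = t, OF _ N assms(2,4) _ assms(5)])
  show "abs_cont_on s T U" using assms(1) by (intro abs_cont_on_subinterval[OF U_ac]) auto
  fix \<tau> assume \<tau>: "\<tau> \<in> {s<..<T} - N" "c < U \<tau>" "U \<tau> < 0"
  then have "\<tau> \<in> {0<..<T} - N" "ln c0 < U \<tau>" using assms(1,3) by auto
  from layer_derivatives[OF this \<tau>(3)] obtain d where d: "d \<le> 0" "(U has_real_derivative d) (at \<tau> within {0..T})"
    by blast
  then show "\<exists>d\<le>0. (U has_real_derivative d) (at \<tau> within {s..T})"
    using DERIV_subset[OF d(2), of "{s..T}"] assms(1) by auto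
qed

lemma U_neg:
  assumes "t \<in> {0..T}"
  shows "U t < 0"
proof -
  have "U 0 < 0" using y0 exp_sum_pos[OF r_pos, of \<gamma> "y 0"] by (simp add: U_def)
  \<comment> \<open>The initial value may lie on either side of \<open>ln c0\<close>, hence the
    maximum as barrier level.\<close>
  then have "max (U 0) (ln c0) < 0" using ln_c0_less by simp
  then show ?thesis using U_barrier[of 0 "max (U 0) (ln c0)" t] assms by fastforce
qed

lemma y_in: "t \<in> {0..T} \<Longrightarrow> y t \<in> C"
  using U_neg U_neg_in_C by blast

definition h :: "real \<Rightarrow> 'a" where "h t = y t - x t"

lemma h_ac: "abs_cont_on 0 T h"
  unfolding h_def by (rule abs_cont_on_diff[OF y_ac x_ac])

text \<open>In the layer \<open>U\<close> can fall at most from 0 to \<open>ln c0\<close>, and this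
  drop is converted into distance at the rate \<open>5 / (2 * \<eta> * \<gamma>)\<close>.\<close>

definition K :: real where "K = norm (h 0) + 5 / (2 * \<eta> * \<gamma>) * (- ln c0)"

lemma layer_bound:
  assumes t: "t \<in> {0..T}" and U: "\<And>s. 0 \<le> s \<Longrightarrow> s < t \<Longrightarrow> ln c0 < U s" "ln c0 \<le> U t"
  shows "norm (h t) \<le> K"
proof -
  define b where "b = 5 / (2 * \<eta> * \<gamma>)"
  have b: "b > 0" using \<eta>_pos \<gamma>_pos by (simp add: b_def)
  have "norm (h t - h 0) \<le> b * U 0 - b * U t"
  proof (rule abs_cont_on_norm_bound[where g = "\<lambda>\<tau>. b * U \<tau>", OF _ _ _ N])
    show "abs_cont_on 0 t h" using t by (intro abs_cont_on_subinterval[OF h_ac]) auto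
    have U': "abs_cont_on 0 t U" using t by (intro abs_cont_on_subinterval[OF U_ac]) auto
    show "abs_cont_on 0 t (\<lambda>\<tau>. b * U \<tau>)"
      by (rule abs_cont_on_dominated[OF U' U', of _ b 0]) (use b in \<open>simp add: dist_real_def abs_mult flip: right_diff_distrib\<close>)
    fix \<tau> assume \<tau>: "\<tau> \<in> {0<..<t} - N"
    then have "\<tau> \<in> {0<..<T} - N" "ln c0 < U \<tau>" "U \<tau> < 0" using t U(1) U_neg by auto
    from layer_derivatives[OF this] obtain v d where vd: "(h has_vector_derivative v) (at \<tau> within {0..T})"
      "(U has_real_derivative d) (at \<tau> within {0..T})" "2 * \<eta> * \<gamma> * norm v \<le> - 5 * d"
      unfolding h_def by blast
    have "(h has_vector_derivative v) (at \<tau> within {0..t})"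
      using t by (intro has_vector_derivative_within_subset[OF vd(1)]) auto
    moreover have "((\<lambda>\<tau>. b * U \<tau>) has_real_derivative b * d) (at \<tau> within {0..t})"
      using DERIV_subset[OF vd(2)] t by (intro DERIV_cmult) auto
    moreover have "norm v \<le> - (b * d)"
      using vd(3) \<eta>_pos \<gamma>_pos by (simp add: b_def field_simps)
    ultimately show "\<exists>v d. (h has_vector_derivative v) (at \<tau> within {0..t}) \<and>
      ((\<lambda>\<tau>. b * U \<tau>) has_real_derivative d) (at \<tau> within {0..t}) \<and> norm v \<le> - d" by blast
  qed (use t in auto)
  also have "\<dots> = b * (U 0 - U t)" by (simp add: right_diff_distrib)
  also have "\<dots> \<le> b * (- ln c0)"
    using b U(2) U_neg[of 0] T_pos by (intro mult_left_mono) auto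
  finally show ?thesis
    using norm_triangle_ineq2[of "h t" "h 0"] by (simp add: K_def b_def)
qed

section \<open>The energy after the layer\<close>

definition A :: real where "A = 5 * M * m / \<eta> + 2 * M"

text \<open>Twice the largest entropy of \<open>r\<close> penalty terms, each at most
  \<open>c0\<close>; it equals \<open>2 * r * M / \<eta>\<close> times
  \<open>ln (\<eta> * \<gamma> / M) / \<gamma>\<close>.\<close>

definition B :: real where "B = 2 * (real r * (c0 * (- ln c0)))"

lemma A_pos: "A > 0"
  using M_pos m_pos \<eta>_pos by (simp add: A_def add_pos_pos)

lemma B_nonneg: "B \<ge> 0"
  using c0_pos ln_c0_less by (simp add: B_def mult_nonneg_nonpos)

text \<open>Half the derivative splits into three parts: the Lipschitz bound on \<open>f\<close>
  gives \<open>M * g\<close>, hypomonotonicity of the normal cone gives \<open>X / 2\<close>, and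
  the penalty gives \<open>B / 2 + X\<close>. Doubling yields \<open>3 * X\<close>, against the
  \<open>5 * X\<close> contained in \<open>A * g\<close>.\<close>

lemma post_layer_derivative:
  assumes t: "t \<in> {0<..<T} - N" and U: "U t \<le> ln c0"
  obtains d where "((\<lambda>t. h t \<bullet> h t) has_real_derivative d) (at t within {0..T})"
    "d \<le> A * (h t \<bullet> h t) + B"
proof -
  have tT: "t \<in> {0..T}" using t by auto
  have yC: "y t \<in> C" and xC: "x t \<in> C" using tT by (auto intro: y_in x_in)
  obtain p q \<zeta> where D: "(y has_vector_derivative p - penalty_force \<gamma> (y t)) (at t within {0..T})"
      "(x has_vector_derivative q - \<zeta>) (at t within {0..T})" "\<zeta> \<in> clarke_normal_cone C (x t)"
      "norm p \<le> M" "norm q \<le> M" "norm (p - q) \<le> M * norm (y t - x t)"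
    using dynamics[OF t yC] by blast
  define F where "F = penalty_force \<gamma> (y t)"
  define V where "V = exp_sum \<gamma> (y t)"
  define w where "w = h t"
  define g where "g = (norm w)\<^sup>2"
  define X where "X = M * m / \<eta> * g"
  have V: "V \<le> c0" using U c0_less_exp_sum_iff[of t] by (simp add: V_def flip: not_less)
  have \<zeta>: "norm \<zeta> \<le> M" using normal_vector_bound[OF _ D(2,3,5)] t by blast
  have "w \<bullet> (p - q) \<le> norm w * norm (p - q)" by (rule norm_cauchy_schwarz)
  also have "\<dots> \<le> norm w * (M * norm w)" using D(6) by (intro mult_left_mono) (auto simp: w_def h_def)
  finally have 1: "w \<bullet> (p - q) \<le> M * g" by (simp add: g_def power2_eq_square mult_ac)
  have "\<zeta> \<bullet> w \<le> m / (2 * \<eta>) * norm \<zeta> * g"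
    using normal_cone_bound[OF lip xC yC D(3)] m_pos by (simp add: w_def h_def g_def)
  also have "\<dots> \<le> m / (2 * \<eta>) * M * g"
    using \<zeta> m_pos \<eta>_pos by (intro mult_right_mono mult_left_mono) (auto simp: g_def)
  finally have 2: "w \<bullet> \<zeta> \<le> X / 2" by (simp add: X_def inner_commute mult_ac)
  have "- (w \<bullet> F) = (\<Sum>i=1..r. \<gamma> * exp (\<gamma> * \<psi> i (y t)) * (grad (\<psi> i) (y t) \<bullet> (- w)))"
    by (simp add: F_def penalty_force_def inner_sum_right sum_negf inner_commute)
  also have "\<dots> \<le> (\<Sum>i=1..r. c0 * (- ln c0) + \<gamma> * exp (\<gamma> * \<psi> i (y t)) * (m * g))"
  proof (rule sum_mono)
    fix i assume i: "i \<in> {1..r}"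
    define e where "e = exp (\<gamma> * \<psi> i (y t))"
    have e: "0 < e" "e \<le> c0" "ln e = \<gamma> * \<psi> i (y t)"
      using exp_le_exp_sum[OF i, of \<gamma> "y t"] V by (auto simp: e_def V_def)
    \<comment> \<open>The quadratic bound is based at \<open>y t\<close> and evaluated at
      \<open>x t\<close>, where \<open>\<psi> i\<close> is nonpositive. As
      \<open>ln e = \<gamma> * \<psi> i (y t)\<close>, multiplication by \<open>\<gamma> * e\<close>
      turns \<open>- \<psi> i (y t)\<close> into an entropy.\<close>
    have "grad (\<psi> i) (y t) \<bullet> (- w) \<le> - \<psi> i (y t) + m * g"
      using psi_lower_bound[OF i lip[OF i] yC xC] xC i
      by (simp add: w_def h_def g_def mem_C_iff norm_minus_commute) (smt (verit) atLeastAtMost_iff)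
    then have "\<gamma> * e * (grad (\<psi> i) (y t) \<bullet> (- w)) \<le> \<gamma> * e * (- \<psi> i (y t) + m * g)"
      using \<gamma>_pos e(1) by (intro mult_left_mono) auto
    also have "\<dots> = e * (- ln e) + \<gamma> * e * (m * g)" by (simp add: e(3) algebra_simps)
    also have "e * (- ln e) \<le> c0 * (- ln c0)" using e(1,2) c0_le by (rule entropy_bound)
    finally show "\<gamma> * exp (\<gamma> * \<psi> i (y t)) * (grad (\<psi> i) (y t) \<bullet> (- w)) \<le> c0 * (- ln c0) + \<gamma> * exp (\<gamma> * \<psi> i (y t)) * (m * g)"
      by (simp add: e_def)
  qed
  also have "\<dots> = B / 2 + \<gamma> * V * (m * g)"
    by (simp add: B_def V_def exp_sum_def sum.distrib sum_subtractf sum_distrib_left sum_distrib_right)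
  \<comment> \<open>Since \<open>\<gamma> * c0 = M / \<eta>\<close>, the factor
    \<open>\<gamma>\<close> disappears once the sum is below the threshold; inside the layer no such
    bound is available.\<close>
  also have "\<gamma> * V * (m * g) \<le> \<gamma> * c0 * (m * g)"
    using V \<gamma>_pos m_pos by (intro mult_right_mono mult_left_mono) (auto simp: g_def)
  also have "\<gamma> * c0 * (m * g) = X" using \<gamma>_pos by (simp add: X_def c0_def)
  finally have 3: "- (w \<bullet> F) \<le> B / 2 + X" by simp
  define d where "d = ((p - F) - (q - \<zeta>)) \<bullet> (2 *\<^sub>R w)"
  have "(h has_vector_derivative (p - F) - (q - \<zeta>)) (at t within {0..T})"
    unfolding h_def F_def by (rule has_vector_derivative_diff[OF D(1,2)])
  moreover have "GDERIV (\<lambda>z. z \<bullet> z) w :> 2 *\<^sub>R w"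
    unfolding gderiv_def by (auto intro!: derivative_eq_intros simp: inner_commute)
  ultimately have der: "((\<lambda>t. h t \<bullet> h t) has_real_derivative d) (at t within {0..T})"
    unfolding d_def w_def by (rule GDERIV_compose_vector_derivative[rotated])
  have "d = 2 * (w \<bullet> (p - q)) + 2 * (- (w \<bullet> F)) + 2 * (w \<bullet> \<zeta>)"
    by (simp add: d_def inner_diff_left inner_diff_right inner_commute algebra_simps)
  also have "\<dots> \<le> 2 * (M * g) + 3 * X + B" using 1 2 3 by linarith
  also have "\<dots> \<le> A * g + B"
  proof -
    have "0 \<le> X" using M_pos m_pos \<eta>_pos by (simp add: X_def g_def)
    moreover have "A * g = 5 * X + 2 * (M * g)" by (simp add: A_def X_def algebra_simps)
    ultimately show ?thesis by linarith
  qed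
  finally have "d \<le> A * (h t \<bullet> h t) + B" by (simp add: g_def w_def dot_square_norm)
  then show thesis using der that by blast
qed

text \<open>Gronwall's inequality starts at the first time \<open>s\<close> with
  \<open>U s \<le> ln c0\<close>, where the distance is at most \<open>K\<close>. If there is no
  such time up to \<open>t\<close>, the layer bound suffices by itself.\<close>

lemma distance_bound:
  assumes t: "t \<in> {0..T}"
  shows "(norm (y t - x t))\<^sup>2 \<le> exp (A * T) * K\<^sup>2 + B * (exp (A * T) - 1) / A"
proof (cases "\<exists>s\<in>{0..t}. U s \<le> ln c0")
  case False
  then have "norm (h t) \<le> K" using t by (intro layer_bound) force+
  then have "(norm (h t))\<^sup>2 \<le> K\<^sup>2" by (intro power_mono) auto
  also have "\<dots> \<le> exp (A * T) * K\<^sup>2"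
    using A_pos T_pos mult_right_mono[of 1 "exp (A * T)" "K\<^sup>2"] by simp
  also have "\<dots> \<le> exp (A * T) * K\<^sup>2 + B * (exp (A * T) - 1) / A"
    using A_pos T_pos B_nonneg by simp
  finally show ?thesis by (simp add: h_def)
next
  case True
  define S where "S = {0..t} \<inter> U -` {..ln c0}"
  have cont: "continuous_on {0..t} U"
    using abs_cont_on_imp_continuous_on[OF U_ac] t by (auto intro: continuous_on_subset)
  then have "closed S" unfolding S_def by (intro continuous_closed_preimage) auto
  then have "compact ({0..t} \<inter> S)" by (intro compact_Int_closed compact_Icc)
  then have "compact S" by (simp add: S_def)
  moreover have "S \<noteq> {}" using True by (auto simp: S_def)
  ultimately obtain s where s: "s \<in> S" "\<And>s'. s' \<in> S \<Longrightarrow> s \<le> s'"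
    using compact_attains_inf[of S] by blast
  have st: "0 \<le> s" "s \<le> t" "U s \<le> ln c0" "s \<in> {0..T}" using s(1) t by (auto simp: S_def)
  have above: "ln c0 < U s'" if "0 \<le> s'" "s' < s" for s'
    using s(2)[of s'] that st by (cases "U s' \<le> ln c0") (auto simp: S_def)
  have hs: "norm (h s) \<le> K"
  proof (cases "s = 0")
    case True
    have "0 \<le> 5 / (2 * \<eta> * \<gamma>) * (- ln c0)"
      using ln_c0_less \<eta>_pos \<gamma>_pos by (intro mult_nonneg_nonneg) auto
    then show ?thesis using True by (simp add: K_def)
  next
    case False
    \<comment> \<open>Continuity from the left extends the lower bound to the end of the layer. For
      \<open>s = 0\<close> there is no left limit, but the layer is then a single instant.\<close>
    have "ln c0 \<le> U s"
    proof (rule tendsto_lowerbound[where F = "at s within {0..<s}" and f = U])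
      show "(U \<longlongrightarrow> U s) (at s within {0..<s})"
        by (rule tendsto_within_subset[of _ _ _ "{0..t}"]) (use cont st in \<open>auto simp: continuous_on\<close>)
      show "\<forall>\<^sub>F s' in at s within {0..<s}. ln c0 \<le> U s'"
        using above by (auto simp: eventually_at_filter less_imp_le)
      show "at s within {0..<s} \<noteq> bot"
        using False st(1) by (simp add: trivial_limit_within islimpt_Ico)
    qed
    then show ?thesis using above st by (intro layer_bound) auto
  qed
  have "h t \<bullet> h t \<le> exp (A * (t - s)) * (h s \<bullet> h s) + B * (exp (A * (t - s)) - 1) / A"
  proof (rule abs_cont_on_gronwall[OF st(2) _ N A_pos])
    have "abs_cont_on 0 T (\<lambda>t. h t \<bullet> h t)"
    proof (rule abs_cont_on_gradient[OF h_ac])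
      show "GDERIV (\<lambda>z. z \<bullet> z) z :> 2 *\<^sub>R z" for z :: 'a
        unfolding gderiv_def by (auto intro!: derivative_eq_intros simp: inner_commute)
    qed (intro continuous_intros)
    then show "abs_cont_on s t (\<lambda>t. h t \<bullet> h t)" by (rule abs_cont_on_subinterval) (use st t in auto)
    fix \<tau> assume \<tau>: "\<tau> \<in> {s<..<t} - N"
    then have \<tau>': "\<tau> \<in> {0<..<T} - N" using st t by auto
    have "U \<tau> \<le> ln c0" using U_barrier[OF st(4,3) order.refl ln_c0_less, of \<tau>] \<tau> t by auto
    from post_layer_derivative[OF \<tau>' this] obtain d where
      "((\<lambda>t. h t \<bullet> h t) has_real_derivative d) (at \<tau> within {0..T})" "d \<le> A * (h \<tau> \<bullet> h \<tau>) + B" .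
    then show "\<exists>d. ((\<lambda>t. h t \<bullet> h t) has_real_derivative d) (at \<tau> within {s..t}) \<and> d \<le> A * (h \<tau> \<bullet> h \<tau>) + B"
      using DERIV_subset[of _ d \<tau> "{0..T}" "{s..t}"] st t by (intro exI[of _ d]) auto
  qed
  also have "\<dots> \<le> exp (A * T) * K\<^sup>2 + B * (exp (A * T) - 1) / A"
  proof -
    have "A * (t - s) \<le> A * T" using A_pos st t by (intro mult_left_mono) auto
    then have e: "exp (A * (t - s)) \<le> exp (A * T)" by simp
    have "h s \<bullet> h s \<le> K\<^sup>2" unfolding dot_square_norm using hs by (intro power_mono) auto
    then have "exp (A * (t - s)) * (h s \<bullet> h s) \<le> exp (A * T) * K\<^sup>2" using e by (intro mult_mono) auto
    moreover have "B * (exp (A * (t - s)) - 1) / A \<le> B * (exp (A * T) - 1) / A"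
      using e B_nonneg A_pos by (intro divide_right_mono mult_left_mono) auto
    ultimately show ?thesis by linarith
  qed
  finally show ?thesis by (simp add: h_def dot_square_norm)
qed

end

section \<open>Large penalty parameters\<close>

text \<open>Both \<open>\<sigma>\<close> and
  \<open>e = ln (\<eta> * \<gamma> / M) / \<gamma>\<close> have the exact order
  \<open>ln \<gamma> / \<gamma>\<close>. So \<open>\<gamma> * \<sigma>\<close> grows like a
  logarithm, and the squared sum is still small after division by \<open>e\<close>.\<close>

lemma sigma_pen_asymptotics:
  fixes M \<eta> m :: real
  assumes "M > 0" "\<eta> > 0" "m > 0" "r \<ge> 1" "b > 0"
  shows "filterlim (sigma_pen r m M \<eta>) (at_right 0) at_top"
    and "filterlim (\<lambda>\<gamma>. \<gamma> * sigma_pen r m M \<eta> \<gamma>) at_top at_top"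
    and "((\<lambda>\<gamma>. (sigma_pen r m M \<eta> \<gamma> + b * (ln (\<eta> * \<gamma> / M) / \<gamma>))\<^sup>2 / (ln (\<eta> * \<gamma> / M) / \<gamma>)) \<longlongrightarrow> 0) at_top"
proof -
  define R where "R = real r * m / (2 * \<eta>\<^sup>2)"
  define l where "l = ln (real r)"
  define a where "a = \<eta> / (2 * M)"
  define a' where "a' = \<eta> / M"
  have pos: "R > 0" "a > 0" "a' > 0" "b > 0" using assms by (simp_all add: R_def a_def a'_def)
  have \<sigma>: "sigma_pen r m M \<eta> = (\<lambda>\<gamma>. R * (l / \<gamma> + 1 / \<gamma> * ln (a * \<gamma>)))"
    by (simp add: fun_eq_iff sigma_pen_def alpha_pen_def R_def l_def a_def)
  have a': "ln (\<eta> * \<gamma> / M) = ln (a' * \<gamma>)" for \<gamma> by (simp add: a'_def)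
  show "filterlim (sigma_pen r m M \<eta>) (at_right 0) at_top"
    unfolding \<sigma> using pos by real_asymp
  show "filterlim (\<lambda>\<gamma>. \<gamma> * sigma_pen r m M \<eta> \<gamma>) at_top at_top"
    unfolding \<sigma> using pos by real_asymp
  show "((\<lambda>\<gamma>. (sigma_pen r m M \<eta> \<gamma> + b * (ln (\<eta> * \<gamma> / M) / \<gamma>))\<^sup>2 / (ln (\<eta> * \<gamma> / M) / \<gamma>)) \<longlongrightarrow> 0) at_top"
    unfolding \<sigma> a' using pos by real_asymp
qed

text \<open>In units of \<open>r * (M / \<eta>) * D * e\<close>, with
  \<open>e = ln (\<eta> * \<gamma> / M) / \<gamma>\<close>, the linear term on the right is worth at
  least 3. The entropy takes 2, and the remaining 1 absorbs the square on the left, which is of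
  smaller order than \<open>e\<close>.\<close>

lemma eventually_error_bound:
  fixes M \<eta> m E D b :: real
  assumes "M > 0" "\<eta> > 0" "m > 0" "r \<ge> 1" "b > 0" "E > 0" "D > 0"
  shows "\<forall>\<^sub>F \<gamma> in at_top. E * (sigma_pen r m M \<eta> \<gamma> + b * (ln (\<eta> * \<gamma> / M) / \<gamma>))\<^sup>2
      + 2 * (real r * (M / \<eta>)) * (ln (\<eta> * \<gamma> / M) / \<gamma>) * D
      \<le> E * (sigma_pen r m M \<eta> \<gamma>)\<^sup>2 + 8 * \<eta> * M / m * D * sigma_pen r m M \<eta> \<gamma>"
proof -
  define Q where "Q = real r * (M / \<eta>) * D / E"
  have Q: "Q > 0" using assms by (simp add: Q_def)
  note asy = sigma_pen_asymptotics[OF assms(1-5)]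
  have "\<forall>\<^sub>F \<gamma> in at_top. (sigma_pen r m M \<eta> \<gamma> + b * (ln (\<eta> * \<gamma> / M) / \<gamma>))\<^sup>2 / (ln (\<eta> * \<gamma> / M) / \<gamma>) < Q"
    by (rule order_tendstoD(2)[OF asy(3) Q])
  moreover have "\<forall>\<^sub>F \<gamma> in at_top. ln (\<eta> / M * \<gamma>) > 4 * ln 2"
  proof -
    have "\<eta> / M > 0" using assms by simp
    then have "filterlim (\<lambda>\<gamma>. ln (\<eta> / M * \<gamma>)) at_top at_top" by real_asymp
    then show ?thesis unfolding filterlim_at_top_dense by blast
  qed
  ultimately show ?thesis using eventually_gt_at_top[of 0]
  proof eventually_elim
    fix \<gamma> :: real
    define e where "e = ln (\<eta> * \<gamma> / M) / \<gamma>"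
    define \<sigma> where "\<sigma> = sigma_pen r m M \<eta> \<gamma>"
    assume h: "(sigma_pen r m M \<eta> \<gamma> + b * (ln (\<eta> * \<gamma> / M) / \<gamma>))\<^sup>2 / (ln (\<eta> * \<gamma> / M) / \<gamma>) < Q"
      "4 * ln 2 < ln (\<eta> / M * \<gamma>)" "0 < \<gamma>"
    have l: "4 * ln 2 < ln (\<eta> * \<gamma> / M)" using h(2) by simp
    have "ln (2::real) > 0" by simp
    then have e: "e > 0" unfolding e_def using l h(3) by (intro divide_pos_pos) linarith
    have "ln (\<eta> * \<gamma> / M / 2) = ln (\<eta> * \<gamma> / M) - ln 2" using assms h(3) by (intro ln_divide_pos) auto
    \<comment> \<open>The factor 2 in the threshold behind \<open>alpha_pen\<close> costs
      \<open>ln 2 / \<gamma>\<close>; the condition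
      \<open>4 * ln 2 < ln (\<eta> * \<gamma> / M)\<close> limits this loss to a quarter of
      \<open>e\<close>.\<close>
    then have "alpha_pen M \<eta> \<gamma> = e - ln 2 / \<gamma>"
      by (simp add: alpha_pen_def e_def diff_divide_distrib mult.commute)
    moreover have "ln 2 / \<gamma> \<le> e / 4"
      using divide_right_mono[of "ln 2" "ln (\<eta> * \<gamma> / M) / 4" \<gamma>] l h(3) by (simp add: e_def)
    ultimately have \<alpha>: "3 / 4 * e \<le> alpha_pen M \<eta> \<gamma>" by linarith
    have "(real r * m / (2 * \<eta>\<^sup>2)) * (3 / 4 * e) \<le> \<sigma>"
      unfolding \<sigma>_def sigma_pen_def
    proof (rule mult_left_mono)
      have "0 \<le> ln (real r) / \<gamma>" using assms(4) h(3) by simp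
      then show "3 / 4 * e \<le> ln (real r) / \<gamma> + alpha_pen M \<eta> \<gamma>" using \<alpha> by linarith
    qed (use assms in simp)
    then have "8 * \<eta> * M / m * D * ((real r * m / (2 * \<eta>\<^sup>2)) * (3 / 4 * e)) \<le> 8 * \<eta> * M / m * D * \<sigma>"
      using assms by (intro mult_left_mono) auto
    moreover have "8 * \<eta> * M / m * D * ((real r * m / (2 * \<eta>\<^sup>2)) * (3 / 4 * e)) = 3 * (real r * (M / \<eta>) * D * e)"
      using assms by (simp add: field_simps power2_eq_square)
    moreover have "E * (\<sigma> + b * e)\<^sup>2 \<le> real r * (M / \<eta>) * D * e"
    proof -
      have "(\<sigma> + b * e)\<^sup>2 / e < Q" using h(1) by (simp only: e_def \<sigma>_def)
      then have "(\<sigma> + b * e)\<^sup>2 \<le> Q * e" using e by (simp add: pos_divide_less_eq)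
      then have "E * (\<sigma> + b * e)\<^sup>2 \<le> E * (Q * e)" using assms by (intro mult_left_mono) auto
      also have "\<dots> = real r * (M / \<eta>) * D * e" using assms by (simp add: Q_def)
      finally show ?thesis .
    qed
    moreover have "0 \<le> E * \<sigma>\<^sup>2" using assms by simp
    moreover have "2 * (real r * (M / \<eta>)) * e * D = 2 * (real r * (M / \<eta>) * D * e)" by (simp add: mult_ac)
    ultimately have "E * (\<sigma> + b * e)\<^sup>2 + 2 * (real r * (M / \<eta>)) * e * D \<le> E * \<sigma>\<^sup>2 + 8 * \<eta> * M / m * D * \<sigma>"
      by argo
    then show "E * (sigma_pen r m M \<eta> \<gamma> + b * (ln (\<eta> * \<gamma> / M) / \<gamma>))\<^sup>2
      + 2 * (real r * (M / \<eta>)) * (ln (\<eta> * \<gamma> / M) / \<gamma>) * D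
      \<le> E * (sigma_pen r m M \<eta> \<gamma>)\<^sup>2 + 8 * \<eta> * M / m * D * sigma_pen r m M \<eta> \<gamma>"
      by (simp only: e_def \<sigma>_def)
  qed
qed

theorem proposition4p2:
  fixes T M \<eta> M\<psi> :: real
    and f :: "real ^ 'n \<Rightarrow> real ^ 'm \<Rightarrow> real ^ 'n"
    and U :: "(real ^ 'm) set"
    and r :: nat
    and \<psi> :: "nat \<Rightarrow> real ^ 'n \<Rightarrow> real"
    and C :: "(real ^ 'n) set"
    and x0 :: "real ^ 'n"
    and \<gamma> :: "nat \<Rightarrow> real"
  assumes T_pos: "T > 0"
    and U_nonempty: "U \<noteq> {}"
    and r_pos: "r \<ge> 1"
    and C_eq: "C = feasible_set r \<psi>"
    and x0_in: "x0 \<in> C"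
    and f_cont: "continuous_on (C \<times> U) (\<lambda>(x, u). f x u)"
    and M_pos: "M > 0"
    and f_lipschitz: "\<And>u. u \<in> U \<Longrightarrow> M-lipschitz_on UNIV (\<lambda>x. f x u)"
    and f_bounded: "\<And>x u. x \<in> C \<Longrightarrow> u \<in> U \<Longrightarrow> norm (f x u) \<le> M"
    and f_convex: "\<And>x. convex (f x ` U)"
    and U_compact: "compact U"
    and C_nonempty: "C \<noteq> {}"
    and \<psi>_C11: "\<And>i. i \<in> {1..r} \<Longrightarrow> C11 (\<psi> i)"
    and C_compact: "\<And>i. i \<in> {1..r} \<Longrightarrow> compact (sublevel (\<psi> i))"
    and C_connected: "\<And>i. i \<in> {1..r} \<Longrightarrow> CARD('n) > 1 \<Longrightarrow> connected (frontier (sublevel (\<psi> i)))"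
    and C_convex: "\<And>i. i \<in> {1..r} \<Longrightarrow> CARD('n) = 1 \<Longrightarrow> convex (sublevel (\<psi> i))"
    and \<eta>_pos: "\<eta> > 0"
    and qualification: "\<And>c l. active r \<psi> c \<noteq> {} \<Longrightarrow> (\<And>i. i \<in> active r \<psi> c \<Longrightarrow> l i \<ge> 0) \<Longrightarrow>
          (\<Sum>i\<in>active r \<psi> c. l i) = 1 \<Longrightarrow>
          norm (\<Sum>i\<in>active r \<psi> c. l i *\<^sub>R grad (\<psi> i) c) > 2 * \<eta>"
    and M\<psi>_pos: "M\<psi> > 0"
    and M\<psi>_lipschitz: "\<And>i. i \<in> {1..r} \<Longrightarrow> (2 * M\<psi>)-lipschitz_on (convex hull C) (grad (\<psi> i))"
    and \<gamma>_gt: "\<And>k. \<gamma> k > 2 * M / \<eta>"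
    and \<gamma>_lim: "filterlim \<gamma> at_top sequentially"
  shows "\<exists>k8. \<forall>k\<ge>k8. \<forall>u\<in>controls T U. \<forall>x x\<gamma>.
           sweeping_solution T f C x0 u x \<longrightarrow>
           penalized_solution T f r \<psi> (\<gamma> k)
             (initial_point r \<psi> x0 (sigma_pen r M\<psi> M \<eta> (\<gamma> k))) u x\<gamma> \<longrightarrow>
           (\<forall>t\<in>{0..T}.
              (norm (x\<gamma> t - x t))\<^sup>2
                \<le> exp (M_tilde M M\<psi> \<eta> * T) * (sigma_pen r M\<psi> M \<eta> (\<gamma> k))\<^sup>2
                  + 8 * \<eta> * M * (exp (M_tilde M M\<psi> \<eta> * T) - 1) / (M_tilde M M\<psi> \<eta> * M\<psi>)
                    * sigma_pen r M\<psi> M \<eta> (\<gamma> k))"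
proof -
  have "compact C"
  proof -
    have "C \<subseteq> sublevel (\<psi> 1)" "closed C"
      using r_pos compact_imp_closed[OF C_compact] by (auto simp: C_eq feasible_set_def intro!: closed_INT)
    moreover have "compact (sublevel (\<psi> 1))" using C_compact r_pos by simp
    ultimately show ?thesis using compact_Int_closed[of "sublevel (\<psi> 1)" C] by (simp add: inf.absorb2)
  qed
  then interpret qualified_constraints r \<psi> C \<eta>
    using C_eq \<eta>_pos \<psi>_C11 qualification by unfold_locales auto
  define D where "D = (exp (M_tilde M M\<psi> \<eta> * T) - 1) / M_tilde M M\<psi> \<eta>"
  let ?\<sigma> = "sigma_pen r M\<psi> M \<eta>"
  have Mt: "M_tilde M M\<psi> \<eta> > 0" using M_pos M\<psi>_pos \<eta>_pos by (simp add: M_tilde_def add_pos_pos)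
  have D: "D > 0" using Mt T_pos by (simp add: D_def)
  note asy = sigma_pen_asymptotics[OF M_pos \<eta>_pos M\<psi>_pos r_pos zero_less_one]
  have b: "5 / (2 * \<eta>) > 0" using \<eta>_pos by simp
  have "M / \<eta> > 0" using M_pos \<eta>_pos by simp
  have "\<forall>\<^sub>F g in at_top. \<forall>u\<in>controls T U. \<forall>x x\<gamma>.
           sweeping_solution T f C x0 u x \<longrightarrow>
           penalized_solution T f r \<psi> g (initial_point r \<psi> x0 (?\<sigma> g)) u x\<gamma> \<longrightarrow>
           (\<forall>t\<in>{0..T}. (norm (x\<gamma> t - x t))\<^sup>2
                \<le> exp (M_tilde M M\<psi> \<eta> * T) * (?\<sigma> g)\<^sup>2
                  + 8 * \<eta> * M * (exp (M_tilde M M\<psi> \<eta> * T) - 1) / (M_tilde M M\<psi> \<eta> * M\<psi>) * ?\<sigma> g)"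
    \<comment> \<open>None of these eventual conditions mentions a control or a trajectory; this
      makes the threshold uniform in \<open>u\<close>, \<open>x\<close> and
      \<open>x\<gamma>\<close>.\<close>
    using penalty_force_lower_bound[OF \<open>M / \<eta> > 0\<close>] exp_sum_initial_point[OF x0_in asy(1,2) order.refl]
      eventually_error_bound[OF M_pos \<eta>_pos M\<psi>_pos r_pos b exp_gt_zero D, of "M_tilde M M\<psi> \<eta> * T"]
      eventually_ge_at_top[of "exp 1 * M / \<eta>"]
      eventually_compose_filterlim[OF eventually_at_right_less asy(1)]
  proof eventually_elim
    case (elim g)
    show ?case
    proof (intro ballI allI impI)
      fix u x y t
      assume u: "u \<in> controls T U" and sx: "sweeping_solution T f C x0 u x"
        and sy: "penalized_solution T f r \<psi> g (initial_point r \<psi> x0 (?\<sigma> g)) u y" and t: "t \<in> {0..T}"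
      have S: "{0..T} \<in> sets lebesgue" by simp
      have "AE t in lebesgue_on {0..T}. u t \<in> U" using u by (simp add: controls_def)
      then obtain N1 where
        N1: "negligible N1" "\<And>t. t \<in> {0..T} - N1 \<Longrightarrow> u t \<in> U"
        using AE_lebesgue_on_negligible[OF _ S] by blast
      note sx' = sx[unfolded sweeping_solution_def] and sy' = sy[unfolded penalized_solution_def]
      obtain N2 where
        N2: "negligible N2" "\<And>t. t \<in> {0..T} - N2 \<Longrightarrow>
          \<exists>v. (x has_vector_derivative v) (at t within {0..T}) \<and>
            v \<in> {f (x t) (u t) - \<zeta> |\<zeta>. \<zeta> \<in> clarke_normal_cone C (x t)}"
        using AE_lebesgue_on_negligible[OF sx'[THEN conjunct2, THEN conjunct2] S] by blast
      obtain N3 where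
        N3: "negligible N3" "\<And>t. t \<in> {0..T} - N3 \<Longrightarrow>
          (y has_vector_derivative f (y t) (u t) - penalty_force g (y t)) (at t within {0..T})"
        unfolding penalty_force_def
        using AE_lebesgue_on_negligible[OF sy'[THEN conjunct2, THEN conjunct2] S] by blast
      have x_ac: "abs_cont_on 0 T x" and x_0: "x 0 = x0" using sx' by simp_all
      have y_ac: "abs_cont_on 0 T y" and y_0: "y 0 = initial_point r \<psi> x0 (?\<sigma> g)"
        using sy' by simp_all
      \<comment> \<open>The normal cone is empty outside \<open>C\<close>, so the inclusion itself
        places \<open>x t\<close> in \<open>C\<close> for almost every \<open>t\<close>; continuity
        extends this to all times.\<close>
      have x_in: "x t \<in> C" if "t \<in> {0..T}" for t
      proof (rule closed_everywhere_if_almost_everywhere[OF T_pos abs_cont_on_imp_continuous_on[OF x_ac] _ N2(1) _ that])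
        show "x t \<in> C" if "t \<in> {0..T} - N2" for t
          using N2(2)[OF that] by (auto simp: clarke_normal_cone_def)
      qed (use \<open>compact C\<close> in \<open>rule compact_imp_closed\<close>)
      interpret trajectory_pair r \<psi> C \<eta> T M M\<psi> g x y "N1 \<union> N2 \<union> N3"
      proof unfold_locales
        show "exp 1 * M \<le> \<eta> * g" using elim(4) \<eta>_pos by (simp add: field_simps)
        show "2 * \<eta> * g * exp_sum g z \<le> norm (penalty_force g z)"
          if "z \<in> C" "exp_sum g z > M / (\<eta> * g)" for z
          using elim(1) that by (simp add: divide_divide_eq_left)
        show "negligible (N1 \<union> N2 \<union> N3)" using N1(1) N2(1) N3(1) by (intro negligible_Un)
        show "exp_sum g (y 0) < 1" using elim(2) by (simp add: y_0)
        fix t assume t: "t \<in> {0<..<T} - (N1 \<union> N2 \<union> N3)" and yC: "y t \<in> C"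
        obtain \<zeta> where \<zeta>: "(x has_vector_derivative f (x t) (u t) - \<zeta>) (at t within {0..T})"
          "\<zeta> \<in> clarke_normal_cone C (x t)"
          using N2(2)[of t] t by auto
        have ut: "u t \<in> U" using N1(2) t by auto
        have "norm (f (y t) (u t) - f (x t) (u t)) \<le> M * norm (y t - x t)"
          using lipschitz_onD[OF f_lipschitz[OF ut], of "y t" "x t"] by (simp add: dist_norm)
        moreover have "norm (f (y t) (u t)) \<le> M" "norm (f (x t) (u t)) \<le> M"
          using f_bounded[OF _ ut] yC x_in[of t] t by auto
        moreover have "(y has_vector_derivative f (y t) (u t) - penalty_force g (y t)) (at t within {0..T})"
          using N3(2)[of t] t by auto
        ultimately show "\<exists>p q \<zeta>. (y has_vector_derivative p - penalty_force g (y t)) (at t within {0..T}) \<and>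
            (x has_vector_derivative q - \<zeta>) (at t within {0..T}) \<and> \<zeta> \<in> clarke_normal_cone C (x t) \<and>
            norm p \<le> M \<and> norm q \<le> M \<and> norm (p - q) \<le> M * norm (y t - x t)"
          using \<zeta> by blast
      qed (use T_pos M_pos M\<psi>_pos r_pos M\<psi>_lipschitz x_ac y_ac x_in in auto)
      have AM: "A = M_tilde M M\<psi> \<eta>" by (simp add: A_def M_tilde_def)
      have "- ln c0 = ln (\<eta> * g / M)"
        using M_pos \<eta>_pos \<gamma>_pos ln_inverse[of c0] by (simp add: c0_def inverse_eq_divide)
      then have K: "K = norm (h 0) + 5 / (2 * \<eta>) * (ln (\<eta> * g / M) / g)"
        and B: "B = 2 * (real r * (M / \<eta>)) * (ln (\<eta> * g / M) / g)"
        by (simp_all add: K_def B_def c0_def)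
      have "norm (h 0) \<le> ?\<sigma> g"
        using norm_initial_point_diff[of "?\<sigma> g" x0] elim(5) by (simp add: h_def x_0 y_0)
      then have "K \<le> ?\<sigma> g + 5 / (2 * \<eta>) * (ln (\<eta> * g / M) / g)" by (simp add: K)
      moreover have "0 \<le> K"
        using ln_c0_less \<eta>_pos \<gamma>_pos unfolding K_def by (intro add_nonneg_nonneg mult_nonneg_nonneg) auto
      ultimately have "K\<^sup>2 \<le> (?\<sigma> g + 5 / (2 * \<eta>) * (ln (\<eta> * g / M) / g))\<^sup>2" by (rule power_mono)
      then have "exp (A * T) * K\<^sup>2 \<le> exp (A * T) * (?\<sigma> g + 5 / (2 * \<eta>) * (ln (\<eta> * g / M) / g))\<^sup>2"
        by (intro mult_left_mono) auto
      moreover have "(norm (y t - x t))\<^sup>2 \<le> exp (A * T) * K\<^sup>2 + B * D"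
        using distance_bound[OF t] by (simp add: D_def AM)
      moreover have coeff: "8 * \<eta> * M * (exp (M_tilde M M\<psi> \<eta> * T) - 1) / (M_tilde M M\<psi> \<eta> * M\<psi>) = 8 * \<eta> * M / M\<psi> * D"
        by (simp add: D_def)
      ultimately show "(norm (y t - x t))\<^sup>2 \<le> exp (M_tilde M M\<psi> \<eta> * T) * (?\<sigma> g)\<^sup>2
          + 8 * \<eta> * M * (exp (M_tilde M M\<psi> \<eta> * T) - 1) / (M_tilde M M\<psi> \<eta> * M\<psi>) * ?\<sigma> g"
        using elim(3) unfolding B AM coeff by linarith
    qed
  qed
  then show ?thesis using filterlim_iff[THEN iffD1, OF \<gamma>_lim] unfolding eventually_sequentially by blast
qed

end
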